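(* Let $n\ge 1$ and $m\in(0,|B_1|)$, and let $\mathcal{J}(E)=\int_{B_1}u_E\,dx$ for measurable $E\subseteq B_1$. There exists a positive constant $c=c(m,n)$ such that $$\mathcal{J}(B_* )-\mathcal{J}(E)\ge c\,|E\Delta B_*|^2$$ for every measurable set $E\subseteq B_1$ such that $|E|=m$, where $B_*$ is the centered ball of volume $m$. Moreover, the exponent $2$ is optimal, in the sense that the inequality cannot be valid for any lower exponent: for every $\alpha<2$ there is no constant $c>0$ such that $\mathcal{J}(B_* )-\mathcal{J}(E)\ge c\,|E\Delta B_*|^{\alpha}$ for every measurable $E\subseteq B_1$ with $|E|=m$ and $|E\Delta B_*|>0$.
   Context: $B_1$ is the open unit ball of $\mathbb{R}^n$ centered at the origin, $|\cdot|$ denotes Lebesgue measure, $\Delta$ between sets is the symmetric difference. For a measurable set $E\subset B_1$, $u_E\in H^1_0(B_1)$ is the unique weak solution of $-\Delta u_E=\chi_E$ in $B_1$, $u_E=0$ on $\partial B_1$. $B_*$ is the ball centered at the origin with $|B_*|=m$. *)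

theory Defs
  imports "HOL-Analysis.Analysis"
begin

primrec Ck :: "nat \<Rightarrow> ('a::euclidean_space \<Rightarrow> real) \<Rightarrow> bool" where
  "Ck 0 f \<longleftrightarrow> continuous_on UNIV f"
| "Ck (Suc k) f \<longleftrightarrow>
     (\<forall>x. f differentiable (at x)) \<and>
     (\<forall>b\<in>Basis. Ck k (\<lambda>x. frechet_derivative f (at x) b))"

definition smooth :: "('a::euclidean_space \<Rightarrow> real) \<Rightarrow> bool" where
  "smooth f \<longleftrightarrow> (\<forall>k. Ck k f)"

definition test_functions :: "'a::euclidean_space set \<Rightarrow> ('a \<Rightarrow> real) set" where
  "test_functions \<Omega> =
     {\<phi>. smooth \<phi> \<and> compact (closure {x. \<phi> x \<noteq> 0}) \<and> closure {x. \<phi> x \<noteq> 0} \<subseteq> \<Omega>}"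

definition gradient :: "('a::euclidean_space \<Rightarrow> real) \<Rightarrow> 'a \<Rightarrow> 'a" where
  "gradient \<phi> x = (\<Sum>b\<in>Basis. frechet_derivative \<phi> (at x) b *\<^sub>R b)"

text \<open>
  Elements of the function spaces are represented by functions on the whole space, of which
  only the values on the domain matter; almost everywhere equal functions are not identified.
\<close>

definition square_integrable_on ::
    "'a::euclidean_space set \<Rightarrow> ('a \<Rightarrow> 'b::euclidean_space) \<Rightarrow> bool" where
  "square_integrable_on \<Omega> f \<longleftrightarrow>
     set_borel_measurable lebesgue \<Omega> f \<and> set_integrable lebesgue \<Omega> (\<lambda>x. (norm (f x))\<^sup>2)"

definition has_weak_gradient ::
    "'a::euclidean_space set \<Rightarrow> ('a \<Rightarrow> real) \<Rightarrow> ('a \<Rightarrow> 'a) \<Rightarrow> bool" where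
  "has_weak_gradient \<Omega> u g \<longleftrightarrow>
     square_integrable_on \<Omega> u \<and> square_integrable_on \<Omega> g \<and>
     (\<forall>\<phi>\<in>test_functions \<Omega>. \<forall>b\<in>Basis.
        (LINT x:\<Omega>|lebesgue. u x * (gradient \<phi> x \<bullet> b)) =
        - (LINT x:\<Omega>|lebesgue. (g x \<bullet> b) * \<phi> x))"

definition H10 :: "'a::euclidean_space set \<Rightarrow> ('a \<Rightarrow> real) set" where
  "H10 \<Omega> =
     {u. \<exists>g. has_weak_gradient \<Omega> u g \<and>
        (\<exists>\<phi>. (\<forall>k::nat. \<phi> k \<in> test_functions \<Omega>) \<and>
          (\<lambda>k. (LINT x:\<Omega>|lebesgue. (\<phi> k x - u x)\<^sup>2) +
               (LINT x:\<Omega>|lebesgue. (norm (gradient (\<phi> k) x - g x))\<^sup>2)) \<longlonglongrightarrow> 0)}"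

text \<open>For square integrable \<open>f\<close>, testing against \<open>test_functions \<Omega>\<close> amounts to testing
  against \<open>H10 \<Omega>\<close>, by density; this is \<open>- \<Delta> u = f\<close> in \<open>\<Omega>\<close> with zero boundary values.\<close>

definition weak_solution ::
    "'a::euclidean_space set \<Rightarrow> ('a \<Rightarrow> real) \<Rightarrow> ('a \<Rightarrow> real) \<Rightarrow> bool" where
  "weak_solution \<Omega> f u \<longleftrightarrow>
     u \<in> H10 \<Omega> \<and>
     (\<exists>g. has_weak_gradient \<Omega> u g \<and>
        (\<forall>\<phi>\<in>test_functions \<Omega>.
           (LINT x:\<Omega>|lebesgue. g x \<bullet> gradient \<phi> x) = (LINT x:\<Omega>|lebesgue. f x * \<phi> x)))"

text \<open>The solution is unique only up to a null set and up to its values outside the unit ball;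
  neither affects \<open>torsion_functional\<close>.\<close>

definition torsion :: "'a::euclidean_space set \<Rightarrow> 'a \<Rightarrow> real" where
  "torsion E = (SOME u. weak_solution (ball 0 1) (indicat_real E) u)"

definition torsion_functional :: "'a::euclidean_space set \<Rightarrow> real" where
  "torsion_functional E = (LINT x:ball 0 1|lebesgue. torsion E x)"

definition centered_ball :: "real \<Rightarrow> 'a::euclidean_space set" where
  "centered_ball m = (THE B. \<exists>r>0. B = ball 0 r \<and> measure lebesgue B = m)"

lemma centered_ball:
  assumes "m > 0"
  shows "\<exists>r>0. (centered_ball m :: 'a::euclidean_space set) = ball 0 r \<and>
               measure lebesgue (centered_ball m :: 'a set) = m"
proof -
  let ?n = "DIM('a)"
  let ?V = "unit_ball_vol (real ?n)"
  have V: "?V > 0" by simp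
  have vol: "measure lebesgue (ball (0::'a) r) = ?V * r ^ ?n" if "r > 0" for r
    using content_ball[of r "0::'a"] that by simp
  define r where "r = root ?n (m / ?V)"
  have r: "r > 0" "r ^ ?n = m / ?V"
    using assms V by (simp_all add: r_def)
  have "\<exists>!B :: 'a set. \<exists>r>0. B = ball 0 r \<and> measure lebesgue B = m"
  proof (rule ex1I[of _ "ball 0 r"])
    show "\<exists>s>0. ball (0::'a) r = ball 0 s \<and> measure lebesgue (ball (0::'a) r) = m"
      using r vol[of r] V by (intro exI[of _ r]) simp
  next
    fix B :: "'a set"
    assume "\<exists>s>0. B = ball 0 s \<and> measure lebesgue B = m"
    then obtain s where s: "s > 0" "B = ball 0 s" "measure lebesgue B = m" by blast
    have "s ^ ?n = r ^ ?n"
      using s vol[of s] r V by (simp add: field_simps)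
    then have "s = r"
      using s(1) r(1) by (metis DIM_positive less_imp_le power_eq_imp_eq_base)
    then show "B = ball 0 r" using s by simp
  qed
  from theI'[OF this] show ?thesis
    unfolding centered_ball_def by blast
qed

end

theory Submission
  imports Defs
begin

text \<open>
  The torsion of the whole unit ball is explicit, \<open>w x = (1 - (norm x)\<^sup>2) / (2 * n)\<close> in
  dimension \<open>n\<close>, and it turns the functional into an integral: testing the equation of \<open>u\<^sub>E\<close> with \<open>w\<close> and the equation
  \<open>- \<Delta> w = 1\<close> with \<open>u\<^sub>E\<close> shows that \<open>\<integral> u\<^sub>E = \<integral>\<nabla>u\<^sub>E \<bullet> \<nabla>w = \<integral>\<^sub>E w\<close>
  (\<open>torsion_functional_eq\<close>).  If \<open>E\<close> has the volume of the ball \<open>B\<close> of radius \<open>r\<close>, constants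
  cancel and the deficit becomes a transport cost (\<open>torsion_deficit\<close>): up to the factor \<open>1 / (2 * n)\<close>
  it is the integral of \<open>r\<^sup>2 - (norm x)\<^sup>2\<close> over \<open>B - E\<close> plus that of \<open>(norm x)\<^sup>2 - r\<^sup>2\<close> over \<open>E - B\<close>.

  Both integrands vanish to first order on the sphere of radius \<open>r\<close>.  A subset of \<open>B\<close> of volume \<open>d\<close>
  does not fit into a layer at the sphere much thinner than \<open>d\<close>, so half of it lies at a distance at
  least a multiple of \<open>d\<close> from the sphere and costs at least a multiple of \<open>d\<^sup>2\<close>
  (\<open>inner_transport_lower_bound\<close>).  Conversely, moving the mass of a thin shell just inside
  the sphere to one just outside costs no more than a multiple of \<open>d\<^sup>2\<close> (\<open>shell_competitor\<close>), which
  excludes every exponent below 2 (\<open>no_smaller_power\<close>).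

  Two points of analysis carry the first step.  The function \<open>torsion E\<close> is a choice among weak
  solutions, so one has to exist (\<open>weak_solution_exists\<close>): a minimizing sequence of
  the Dirichlet energy on test functions is Cauchy by the parallelogram law and the Poincare
  inequality, and \<open>l2_complete\<close> provides the limit.  And \<open>w\<close> is not a test function, as its support
  reaches the boundary; it is replaced by explicit test functions \<open>approx_torsion k\<close> with
  \<open>\<nabla>(approx_torsion k) \<longlonglongrightarrow> \<nabla>w\<close> in the square mean.
\<close>

section \<open>Square integrable functions\<close>

definition sq_integrable :: "'a measure \<Rightarrow> ('a \<Rightarrow> 'b::euclidean_space) \<Rightarrow> bool" where
  "sq_integrable M f \<longleftrightarrow> f \<in> borel_measurable M \<and> integrable M (\<lambda>x. (norm (f x))\<^sup>2)"

definition l2_dist_sq :: "'a measure \<Rightarrow> ('a \<Rightarrow> 'b::euclidean_space) \<Rightarrow> ('a \<Rightarrow> 'b) \<Rightarrow> real" where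
  "l2_dist_sq M f g = (LINT x|M. (norm (f x - g x))\<^sup>2)"

lemma sq_integrable_inner:
  assumes "sq_integrable M f" "sq_integrable M g"
  shows "integrable M (\<lambda>x. f x \<bullet> g x)"
proof (rule Bochner_Integration.integrable_bound)
  show "integrable M (\<lambda>x. (norm (f x))\<^sup>2 + (norm (g x))\<^sup>2)"
    using assms by (simp add: sq_integrable_def)
  show "(\<lambda>x. f x \<bullet> g x) \<in> borel_measurable M"
    using assms by (auto simp: sq_integrable_def)
  have "\<bar>a \<bullet> b\<bar> \<le> (norm a)\<^sup>2 + (norm b)\<^sup>2" for a b :: 'b
  proof -
    have "\<bar>a \<bullet> b\<bar> \<le> norm a * norm b" by (rule Cauchy_Schwarz_ineq2)
    also have "\<dots> \<le> (norm a)\<^sup>2 + (norm b)\<^sup>2"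
      using sum_squares_bound[of "norm a" "norm b", unfolded mult.assoc]
        mult_nonneg_nonneg[OF norm_ge_zero[of a] norm_ge_zero[of b]] by linarith
    finally show ?thesis .
  qed
  then show "AE x in M. norm (f x \<bullet> g x) \<le> norm ((norm (f x))\<^sup>2 + (norm (g x))\<^sup>2)"
    by simp
qed

lemma sq_integrable_scaleR:
  "sq_integrable M f \<Longrightarrow> sq_integrable M (\<lambda>x. c *\<^sub>R f x)"
  by (auto simp: sq_integrable_def power_mult_distrib)

lemma sq_integrable_add:
  assumes "sq_integrable M f" "sq_integrable M g"
  shows "sq_integrable M (\<lambda>x. f x + g x)"
proof -
  have "integrable M (\<lambda>x. (norm (f x))\<^sup>2 + (norm (g x))\<^sup>2 + 2 * (f x \<bullet> g x))"
    using assms sq_integrable_inner[OF assms] by (simp add: sq_integrable_def)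
  moreover have "(norm (f x + g x))\<^sup>2 = (norm (f x))\<^sup>2 + (norm (g x))\<^sup>2 + 2 * (f x \<bullet> g x)" for x
    by (simp add: power2_norm_eq_inner inner_add inner_commute)
  ultimately show ?thesis
    using assms by (auto simp: sq_integrable_def)
qed

lemma sq_integrable_diff:
  assumes "sq_integrable M f" "sq_integrable M g"
  shows "sq_integrable M (\<lambda>x. f x - g x)"
  using sq_integrable_add[OF assms(1) sq_integrable_scaleR[OF assms(2), of "-1"]] by simp

lemma sq_integrable_component:
  assumes "sq_integrable M f"
  shows "sq_integrable M (\<lambda>x. f x \<bullet> b)"
proof -
  have "integrable M (\<lambda>x. (f x \<bullet> b)\<^sup>2)"
  proof (rule Bochner_Integration.integrable_bound)
    show "integrable M (\<lambda>x. (norm b)\<^sup>2 * (norm (f x))\<^sup>2)"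
      using assms by (auto simp: sq_integrable_def)
    show "(\<lambda>x. (f x \<bullet> b)\<^sup>2) \<in> borel_measurable M"
      using assms by (auto simp: sq_integrable_def)
    have "(a \<bullet> b)\<^sup>2 \<le> (norm b)\<^sup>2 * (norm a)\<^sup>2" for a
      using Cauchy_Schwarz_ineq2[of a b] abs_le_square_iff[of "a \<bullet> b" "norm a * norm b"]
      by (simp add: power_mult_distrib mult.commute)
    then show "AE x in M. norm ((f x \<bullet> b)\<^sup>2) \<le> norm ((norm b)\<^sup>2 * (norm (f x))\<^sup>2)"
      by simp
  qed
  then show ?thesis using assms by (auto simp: sq_integrable_def)
qed

text \<open>
  The quadratic polynomial \<open>t \<mapsto> \<integral> (norm (f x - t *\<^sub>R g x))\<^sup>2\<close> is nonnegative; its value at the vertex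
  is the claim.
\<close>

lemma l2_Cauchy_Schwarz:
  assumes f: "sq_integrable M f" and g: "sq_integrable M g"
  shows "(LINT x|M. f x \<bullet> g x)\<^sup>2 \<le> (LINT x|M. (norm (f x))\<^sup>2) * (LINT x|M. (norm (g x))\<^sup>2)"
proof -
  define A B C where "A = (LINT x|M. (norm (f x))\<^sup>2)" and "B = (LINT x|M. f x \<bullet> g x)"
    and "C = (LINT x|M. (norm (g x))\<^sup>2)"
  have pos: "0 \<le> A - 2 * t * B + t\<^sup>2 * C" for t
  proof -
    have "0 \<le> (LINT x|M. (norm (f x - t *\<^sub>R g x))\<^sup>2)" by simp
    also have "\<dots> = (LINT x|M. (norm (f x))\<^sup>2 - 2 * t * (f x \<bullet> g x) + t\<^sup>2 * (norm (g x))\<^sup>2)"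
      by (rule Bochner_Integration.integral_cong)
        (simp_all only: power2_norm_eq_inner, simp add: inner_diff inner_commute power2_eq_square algebra_simps)
    also have "\<dots> = A - 2 * t * B + t\<^sup>2 * C"
      using f g sq_integrable_inner[OF f g] by (simp add: A_def B_def C_def sq_integrable_def)
    finally show ?thesis .
  qed
  have "C \<ge> 0" by (simp add: C_def)
  have "B\<^sup>2 \<le> A * C"
  proof (cases "C = 0")
    case True
    have "B = 0"
    proof (rule ccontr)
      assume "B \<noteq> 0"
      with True pos[of "(A + 1) / (2 * B)"] show False by simp
    qed
    with True show ?thesis by simp
  next
    case False
    then have "C > 0" using \<open>C \<ge> 0\<close> by simp
    have "0 \<le> A - 2 * (B / C) * B + (B / C)\<^sup>2 * C" by (rule pos)
    also have "\<dots> = A - B\<^sup>2 / C"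
      using \<open>C > 0\<close> by (simp add: field_simps power2_eq_square)
    finally show ?thesis using \<open>C > 0\<close> by (simp add: field_simps)
  qed
  then show ?thesis by (simp add: A_def B_def C_def)
qed

text \<open>
  Convergence in the square mean implies weak convergence; every passage to the limit below has
  this form.
\<close>

lemma l2_tendsto_inner:
  assumes f: "\<And>k. sq_integrable M (f k)" "sq_integrable M f'" and h: "sq_integrable M h"
    and lim: "(\<lambda>k. l2_dist_sq M (f k) f') \<longlonglongrightarrow> 0"
  shows "(\<lambda>k. LINT x|M. f k x \<bullet> h x) \<longlonglongrightarrow> (LINT x|M. f' x \<bullet> h x)"
proof -
  have eq: "(LINT x|M. f k x \<bullet> h x) - (LINT x|M. f' x \<bullet> h x) = (LINT x|M. (f k x - f' x) \<bullet> h x)" for k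
    using sq_integrable_inner[OF f(1) h] sq_integrable_inner[OF f(2) h]
    by (simp add: inner_diff_left)
  have "(\<lambda>k. (LINT x|M. (f k x - f' x) \<bullet> h x)\<^sup>2) \<longlonglongrightarrow> 0"
  proof (rule tendsto_sandwich[OF always_eventually always_eventually tendsto_const])
    show "\<forall>k. (LINT x|M. (f k x - f' x) \<bullet> h x)\<^sup>2
        \<le> l2_dist_sq M (f k) f' * (LINT x|M. (norm (h x))\<^sup>2)"
      unfolding l2_dist_sq_def using l2_Cauchy_Schwarz[OF sq_integrable_diff[OF f] h] by blast
    show "(\<lambda>k. l2_dist_sq M (f k) f' * (LINT x|M. (norm (h x))\<^sup>2)) \<longlonglongrightarrow> 0"
      using tendsto_mult_left_zero[OF lim] by blast
  qed simp
  then have "(\<lambda>k. LINT x|M. (f k x - f' x) \<bullet> h x) \<longlonglongrightarrow> 0"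
    by (simp add: power_tendsto_0_iff)
  then show ?thesis
    by (simp add: eq[symmetric] LIM_zero_iff)
qed

text \<open>
  On a finite measure space a Cauchy sequence in the square mean is Cauchy in the mean, so a
  subsequence converges almost everywhere.  Fatou's lemma shows that its pointwise limit is also the
  limit of the whole sequence in the square mean.
\<close>

lemma l2_complete:
  fixes f :: "nat \<Rightarrow> 'a \<Rightarrow> 'b::euclidean_space"
  assumes fin: "finite_measure M" and f: "\<And>k. sq_integrable M (f k)"
    and cauchy: "\<And>e. e > 0 \<Longrightarrow> \<exists>N. \<forall>i\<ge>N. \<forall>j\<ge>N. l2_dist_sq M (f i) (f j) < e"
  obtains f' where "sq_integrable M f'" "(\<lambda>k. l2_dist_sq M (f k) f') \<longlonglongrightarrow> 0"
proof -
  interpret finite_measure M by (rule fin)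
  have meas[measurable]: "\<And>k. f k \<in> borel_measurable M" using f by (simp add: sq_integrable_def)
  have one: "sq_integrable M (\<lambda>_. 1::real)" by (simp add: sq_integrable_def)
  have normsq: "sq_integrable M (\<lambda>x. norm (h x))" if "sq_integrable M h" for h :: "'a \<Rightarrow> 'b"
    using that by (auto simp: sq_integrable_def)
  have int_norm: "integrable M (\<lambda>x. norm (h x))" if "sq_integrable M h" for h :: "'a \<Rightarrow> 'b"
    using sq_integrable_inner[OF normsq[OF that] one] by simp
  have int: "integrable M (f k)" for k
    using int_norm[OF f] by (simp add: integrable_norm_iff)
  have L1: "\<exists>N. \<forall>i\<ge>N. \<forall>j\<ge>N. (LINT x|M. norm (f i x - f j x)) < e" if "e > 0" for e
  proof -
    let ?m = "measure M (space M) + 1"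
    have m: "?m > 0" using measure_nonneg[of M "space M"] by linarith
    obtain N where N: "\<And>i j. i \<ge> N \<Longrightarrow> j \<ge> N \<Longrightarrow> l2_dist_sq M (f i) (f j) < e\<^sup>2 / ?m"
      using cauchy[of "e\<^sup>2 / ?m"] m \<open>e > 0\<close> by (meson divide_pos_pos zero_less_power)
    have "(LINT x|M. norm (f i x - f j x)) < e" if "i \<ge> N" "j \<ge> N" for i j
    proof -
      have "(LINT x|M. norm (f i x - f j x))\<^sup>2 \<le> l2_dist_sq M (f i) (f j) * measure M (space M)"
        using l2_Cauchy_Schwarz[OF normsq[OF sq_integrable_diff[OF f f]] one]
        by (simp add: l2_dist_sq_def)
      also have "\<dots> \<le> l2_dist_sq M (f i) (f j) * ?m"
        by (intro mult_left_mono) (auto simp: l2_dist_sq_def)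
      also have "\<dots> < e\<^sup>2" using N[OF that] m by (simp add: field_simps)
      finally show ?thesis using \<open>e > 0\<close> by (simp add: power_less_imp_less_base)
    qed
    then show ?thesis by blast
  qed
  obtain r where r: "strict_mono r" and AEC: "AE x in M. Cauchy (\<lambda>i. f (r i) x)"
    by (rule cauchy_L1_AE_cauchy_subseq[OF int L1])
  \<comment> \<open>The value 0 off the set of convergence only serves to make the limit measurable.\<close>
  define f' where "f' x = (if Cauchy (\<lambda>i. f (r i) x) then lim (\<lambda>i. f (r i) x) else 0)" for x
  have [measurable]: "f' \<in> borel_measurable M" unfolding f'_def by measurable
  have conv: "AE x in M. (\<lambda>i. f (r i) x) \<longlonglongrightarrow> f' x"
    using AEC by eventually_elim (auto simp: f'_def Cauchy_convergent_iff convergent_LIMSEQ_iff)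
  have fatou: "(\<integral>\<^sup>+x. ennreal ((norm (f k x - f' x))\<^sup>2) \<partial>M) \<le> ennreal e"
    if N: "\<And>j. j \<ge> N \<Longrightarrow> l2_dist_sq M (f k) (f j) < e" for k N e
  proof -
    have "(\<integral>\<^sup>+x. ennreal ((norm (f k x - f' x))\<^sup>2) \<partial>M)
        = (\<integral>\<^sup>+x. liminf (\<lambda>i. ennreal ((norm (f k x - f (r i) x))\<^sup>2)) \<partial>M)"
    proof (rule nn_integral_cong_AE, use conv in eventually_elim)
      case (elim x)
      have "(\<lambda>i. ennreal ((norm (f k x - f (r i) x))\<^sup>2)) \<longlonglongrightarrow> ennreal ((norm (f k x - f' x))\<^sup>2)"
        by (intro tendsto_ennrealI tendsto_intros elim)
      from lim_imp_Liminf[OF _ this] show ?case by simp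
    qed
    also have "\<dots> \<le> liminf (\<lambda>i. \<integral>\<^sup>+x. ennreal ((norm (f k x - f (r i) x))\<^sup>2) \<partial>M)"
      by (rule nn_integral_liminf) measurable
    also have "\<dots> \<le> ennreal e"
    proof -
      have "eventually (\<lambda>i. (\<integral>\<^sup>+x. ennreal ((norm (f k x - f (r i) x))\<^sup>2) \<partial>M) \<le> ennreal e) sequentially"
      proof (rule eventually_sequentiallyI[of N])
        fix i assume "N \<le> i"
        then have "N \<le> r i" using r by (meson order_trans seq_suble)
        have "(\<integral>\<^sup>+x. ennreal ((norm (f k x - f (r i) x))\<^sup>2) \<partial>M) = ennreal (l2_dist_sq M (f k) (f (r i)))"
          unfolding l2_dist_sq_def using sq_integrable_diff[OF f f]
          by (intro nn_integral_eq_integral) (auto simp: sq_integrable_def)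
        also have "\<dots> \<le> ennreal e" using N[OF \<open>N \<le> r i\<close>] by (intro ennreal_leI) simp
        finally show "(\<integral>\<^sup>+x. ennreal ((norm (f k x - f (r i) x))\<^sup>2) \<partial>M) \<le> ennreal e" .
      qed
      then have "liminf (\<lambda>i. \<integral>\<^sup>+x. ennreal ((norm (f k x - f (r i) x))\<^sup>2) \<partial>M) \<le> liminf (\<lambda>i::nat. ennreal e)"
        by (rule Liminf_mono)
      then show ?thesis by (simp add: Liminf_const)
    qed
    finally show ?thesis .
  qed
  have diff_sq: "sq_integrable M (\<lambda>x. f k x - f' x)" and bound: "l2_dist_sq M (f k) f' \<le> e"
    if "\<And>j. j \<ge> N \<Longrightarrow> l2_dist_sq M (f k) (f j) < e" "e > 0" for k N e
  proof -
    have le: "(\<integral>\<^sup>+x. ennreal ((norm (f k x - f' x))\<^sup>2) \<partial>M) \<le> ennreal e"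
      by (rule fatou[OF that(1)])
    then have "integrable M (\<lambda>x. (norm (f k x - f' x))\<^sup>2)"
      by (intro integrableI_bounded) (auto simp: le_less_trans)
    then show "sq_integrable M (\<lambda>x. f k x - f' x)" by (auto simp: sq_integrable_def)
    show "l2_dist_sq M (f k) f' \<le> e"
      using le \<open>e > 0\<close> unfolding l2_dist_sq_def
      by (subst (asm) nn_integral_eq_integral[OF \<open>integrable M (\<lambda>x. (norm (f k x - f' x))\<^sup>2)\<close>]) auto
  qed
  obtain N1 where N1: "\<And>i j. i \<ge> N1 \<Longrightarrow> j \<ge> N1 \<Longrightarrow> l2_dist_sq M (f i) (f j) < 1"
    using cauchy[of 1] by auto
  show thesis
  proof (rule that[of f'])
    have "sq_integrable M (\<lambda>x. f N1 x - f' x)" by (rule diff_sq[of N1 _ 1]) (auto intro: N1)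
    from sq_integrable_diff[OF f this, of N1] show "sq_integrable M f'" by simp
    show "(\<lambda>k. l2_dist_sq M (f k) f') \<longlonglongrightarrow> 0"
    proof (rule LIMSEQ_I)
      fix e :: real assume "e > 0"
      then obtain N where N: "\<And>i j. i \<ge> N \<Longrightarrow> j \<ge> N \<Longrightarrow> l2_dist_sq M (f i) (f j) < e / 2"
        using cauchy[of "e / 2"] by auto
      have "norm (l2_dist_sq M (f k) f' - 0) < e" if "k \<ge> N" for k
      proof -
        have "l2_dist_sq M (f k) f' \<le> e / 2"
          by (rule bound[of N]) (use N that \<open>e > 0\<close> in auto)
        moreover have "l2_dist_sq M (f k) f' \<ge> 0" by (simp add: l2_dist_sq_def)
        ultimately show ?thesis using \<open>e > 0\<close> by simp
      qed
      then show "\<exists>N. \<forall>k\<ge>N. norm (l2_dist_sq M (f k) f' - 0) < e" by blast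
    qed
  qed
qed

section \<open>Smooth functions and integration by parts\<close>

lemma frechet_derivative_eqI:
  "(f has_derivative f') (at x) \<Longrightarrow> frechet_derivative f (at x) b = f' b"
  by (metis frechet_derivative_at)

lemma Ck_add: "Ck k f \<Longrightarrow> Ck k g \<Longrightarrow> Ck k (\<lambda>x. f x + g x)"
proof (induction k arbitrary: f g)
  case 0
  then show ?case by (simp add: continuous_on_add)
next
  case (Suc k)
  have "frechet_derivative (\<lambda>x. f x + g x) (at x) b
      = frechet_derivative f (at x) b + frechet_derivative g (at x) b" for x b
    using Suc.prems by (intro frechet_derivative_eqI has_derivative_add)
      (auto simp: frechet_derivative_works)
  then show ?case using Suc by auto
qed

lemma Ck_scale: "Ck k f \<Longrightarrow> Ck k (\<lambda>x. c * f x)"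
proof (induction k arbitrary: f)
  case 0
  then show ?case by (simp add: continuous_on_mult_left)
next
  case (Suc k)
  have "frechet_derivative (\<lambda>x. c * f x) (at x) b = c * frechet_derivative f (at x) b" for x b
    using Suc.prems by (intro frechet_derivative_eqI has_derivative_mult_right)
      (auto simp: frechet_derivative_works)
  then show ?case using Suc by auto
qed

lemma smooth_has_derivative: "smooth f \<Longrightarrow> (f has_derivative frechet_derivative f (at x)) (at x)"
  unfolding smooth_def by (metis Ck.simps(2) frechet_derivative_works)

lemma smooth_partial: "smooth f \<Longrightarrow> b \<in> Basis \<Longrightarrow> smooth (\<lambda>x. frechet_derivative f (at x) b)"
  unfolding smooth_def by (metis Ck.simps(2))

lemma smooth_continuous: "smooth f \<Longrightarrow> continuous_on UNIV f"
  unfolding smooth_def by (metis Ck.simps(1))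

lemma gradient_inner_Basis: "b \<in> Basis \<Longrightarrow> gradient f x \<bullet> b = frechet_derivative f (at x) b"
  by (simp add: gradient_def inner_sum_left inner_Basis if_distrib sum.delta cong: if_cong)

lemma continuous_gradient:
  assumes "smooth f"
  shows "continuous_on UNIV (gradient f)"
  unfolding gradient_def using smooth_continuous[OF smooth_partial[OF assms]]
  by (intro continuous_on_sum continuous_on_scaleR) auto

lemma gradient_linear_combination:
  assumes "smooth f" "smooth g"
  shows "gradient (\<lambda>x. f x + c * g x) x = gradient f x + c *\<^sub>R gradient g x"
proof -
  have "frechet_derivative (\<lambda>x. f x + c * g x) (at x) b
      = frechet_derivative f (at x) b + c * frechet_derivative g (at x) b" for b
    by (intro frechet_derivative_eqI has_derivative_add has_derivative_mult_right
        smooth_has_derivative assms)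
  then show ?thesis
    by (simp add: gradient_def scaleR_add_left sum.distrib scaleR_sum_right)
qed

lemma test_function_smooth: "\<phi> \<in> test_functions \<Omega> \<Longrightarrow> smooth \<phi>"
  by (simp add: test_functions_def)

lemma test_function_support:
  assumes "\<phi> \<in> test_functions \<Omega>"
  obtains K where "compact K" "K \<subseteq> \<Omega>" "\<And>x. x \<notin> K \<Longrightarrow> \<phi> x = 0"
proof (rule that[of "closure {x. \<phi> x \<noteq> 0}"])
  show "\<phi> x = 0" if "x \<notin> closure {x. \<phi> x \<noteq> 0}" for x
    using that closure_subset[of "{x. \<phi> x \<noteq> 0}"] by auto
qed (use assms in \<open>auto simp: test_functions_def\<close>)

lemma test_functionI:
  assumes "smooth \<phi>" "compact K" "K \<subseteq> \<Omega>" "\<And>x. x \<notin> K \<Longrightarrow> \<phi> x = 0"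
  shows "\<phi> \<in> test_functions \<Omega>"
proof -
  have "closure {x. \<phi> x \<noteq> 0} \<subseteq> K"
    using assms(2,4) by (intro closure_minimal) (auto simp: compact_imp_closed)
  moreover have "compact (closure {x. \<phi> x \<noteq> 0})"
    using calculation assms(2) by (metis closed_closure compact_Int_closed inf.absorb_iff2)
  ultimately show ?thesis using assms by (auto simp: test_functions_def)
qed

lemma test_functions_linear_combination:
  assumes "\<phi> \<in> test_functions \<Omega>" "\<psi> \<in> test_functions \<Omega>"
  shows "(\<lambda>x. \<phi> x + c * \<psi> x) \<in> test_functions \<Omega>"
proof -
  obtain K where K: "compact K" "K \<subseteq> \<Omega>" "\<And>x. x \<notin> K \<Longrightarrow> \<phi> x = 0"
    using test_function_support[OF assms(1)] by blast
  obtain L where L: "compact L" "L \<subseteq> \<Omega>" "\<And>x. x \<notin> L \<Longrightarrow> \<psi> x = 0"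
    using test_function_support[OF assms(2)] by blast
  show ?thesis
  proof (rule test_functionI)
    show "smooth (\<lambda>x. \<phi> x + c * \<psi> x)"
      using assms by (auto simp: test_functions_def smooth_def intro!: Ck_add Ck_scale)
    show "compact (K \<union> L)" using K(1) L(1) by (rule compact_Un)
    show "K \<union> L \<subseteq> \<Omega>" using K(2) L(2) by (rule Un_least)
    show "\<phi> x + c * \<psi> x = 0" if "x \<notin> K \<union> L" for x
      using that K(3)[of x] L(3)[of x] by simp
  qed
qed

lemma zero_test_function: "(\<lambda>x. 0) \<in> test_functions \<Omega>"
proof (rule test_functionI[of _ "{}"])
  have "Ck k (\<lambda>x::'a. 0)" for k
  proof (induction k)
    case (Suc k)
    have "frechet_derivative (\<lambda>x::'a. 0::real) (at x) b = 0" for x b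
      by (rule frechet_derivative_eqI) (rule has_derivative_const)
    with Suc show ?case by simp
  qed simp
  then show "smooth (\<lambda>x::'a. 0)" by (simp add: smooth_def)
qed auto

lemma derivative_eq_0_outside_support:
  fixes F :: "'a::real_normed_vector \<Rightarrow> 'b::real_normed_vector"
  assumes "(F has_derivative F') (at x)" "closed K" "\<And>y. y \<notin> K \<Longrightarrow> F y = 0" "x \<notin> K"
  shows "F' b = 0"
proof -
  have "((\<lambda>y. 0) has_derivative F') (at x)"
    by (rule has_derivative_transform_within_open[of F F' x UNIV "- K"]) (use assms in auto)
  then show ?thesis
    using has_derivative_unique[OF has_derivative_const] by metis
qed

lemma integrable_lborel_compact_support:
  fixes h :: "'a::euclidean_space \<Rightarrow> real"
  assumes "continuous_on UNIV h" "compact K" "\<And>x. x \<notin> K \<Longrightarrow> h x = 0"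
  shows "integrable lborel h"
proof -
  have "integrable lborel (\<lambda>x. indicator K x *\<^sub>R h x)"
    by (rule borel_integrable_compact) (use assms in \<open>auto intro: continuous_on_subset\<close>)
  moreover have "(\<lambda>x. indicator K x *\<^sub>R h x) = h"
    using assms(3) by (auto simp: indicator_def fun_eq_iff)
  ultimately show ?thesis by simp
qed

text \<open>
  The integral of \<open>F\<close> is invariant under translation, so the difference quotients of \<open>F\<close> in direction
  \<open>b\<close> have integral zero.  They are uniformly bounded and live on one ball, hence the same holds for
  their limit, the derivative of \<open>F\<close> in direction \<open>b\<close>.
\<close>

lemma integral_partial_derivative_eq_0:
  fixes F :: "'a::euclidean_space \<Rightarrow> real"
  assumes der: "\<And>x. (F has_derivative F' x) (at x)"
    and cont: "continuous_on UNIV (\<lambda>x. F' x b)"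
    and K: "compact K" "\<And>x. x \<notin> K \<Longrightarrow> F x = 0"
  shows "(LINT x|lborel. F' x b) = 0"
proof -
  have F'0: "F' x b = 0" if "x \<notin> K" for x
    by (rule derivative_eq_0_outside_support[OF der compact_imp_closed[OF K(1)] K(2) that])
  have contF: "continuous_on UNIV F"
    using der by (meson continuous_at_imp_continuous_on has_derivative_continuous)
  obtain R where R: "\<And>x. x \<in> K \<Longrightarrow> norm x \<le> R"
    using compact_imp_bounded[OF K(1)] by (auto simp: bounded_iff)
  have "bounded ((\<lambda>x. F' x b) ` K)"
    by (intro compact_imp_bounded compact_continuous_image K continuous_on_subset[OF cont]) auto
  then obtain B where B: "\<And>x. x \<in> K \<Longrightarrow> \<bar>F' x b\<bar> \<le> B"
    by (auto simp: bounded_iff)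
  have B': "\<bar>F' x b\<bar> \<le> \<bar>B\<bar>" for x
    using F'0[of x] B[of x] by (cases "x \<in> K") auto
  define s where "s k = 1 / (real k + 1)" for k
  have s: "0 < s k" "s k \<le> 1" for k by (auto simp: s_def)
  have s0: "s \<longlonglongrightarrow> 0" unfolding s_def using LIMSEQ_inverse_real_of_nat by (simp add: inverse_eq_divide add.commute)
  define D where "D k x = (F (x + s k *\<^sub>R b) - F x) / s k" for k x
  have mvt: "\<exists>t. 0 \<le> t \<and> t \<le> s k \<and> D k x = F' (x + t *\<^sub>R b) b" for k x
  proof -
    have "\<exists>t\<in>{0<..<s k}. F (x + s k *\<^sub>R b) - F (x + 0 *\<^sub>R b) = (\<lambda>h. F' (x + t *\<^sub>R b) (h *\<^sub>R b)) (s k - 0)"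
    proof (rule mvt_simple[where a = 0 and b = "s k" and f = "\<lambda>t. F (x + t *\<^sub>R b)"
            and f' = "\<lambda>t h. F' (x + t *\<^sub>R b) (h *\<^sub>R b)"])
      fix t
      have "((\<lambda>t. x + t *\<^sub>R b) has_derivative (\<lambda>h. h *\<^sub>R b)) (at t within {0..s k})"
        by (auto intro!: derivative_eq_intros)
      from has_derivative_compose[OF this der]
      show "((\<lambda>t. F (x + t *\<^sub>R b)) has_derivative (\<lambda>h. F' (x + t *\<^sub>R b) (h *\<^sub>R b))) (at t within {0..s k})" .
    qed (rule s)
    then obtain t where t: "0 < t" "t < s k" "F (x + s k *\<^sub>R b) - F x = F' (x + t *\<^sub>R b) (s k *\<^sub>R b)"
      by auto
    have "F' (x + t *\<^sub>R b) (s k *\<^sub>R b) = s k * F' (x + t *\<^sub>R b) b"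
      using linear_cmul[OF has_derivative_linear[OF der]] by simp
    with t s[of k] show ?thesis by (intro exI[of _ t]) (simp add: D_def)
  qed
  have lim: "(\<lambda>k. D k x) \<longlonglongrightarrow> F' x b" for x
  proof -
    obtain t where t: "\<And>k. 0 \<le> t k \<and> t k \<le> s k \<and> D k x = F' (x + t k *\<^sub>R b) b"
      using mvt[of _ x] by metis
    have "t \<longlonglongrightarrow> 0"
      by (rule tendsto_sandwich[OF _ _ tendsto_const s0]) (use t in auto)
    then have "(\<lambda>k. x + t k *\<^sub>R b) \<longlonglongrightarrow> x + 0 *\<^sub>R b" by (intro tendsto_intros)
    moreover have "isCont (\<lambda>x. F' x b) x"
      using cont by (simp add: continuous_on_eq_continuous_at)
    ultimately have "(\<lambda>k. F' (x + t k *\<^sub>R b) b) \<longlonglongrightarrow> F' x b"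
      by (intro isCont_tendsto_compose[where g = "\<lambda>x. F' x b" and l = x]) auto
    then show ?thesis using t by simp
  qed
  have intF: "integrable lborel F" by (rule integrable_lborel_compact_support[OF contF K])
  have trans: "integrable lborel (\<lambda>x. F (x + c))" "(LINT x|lborel. F (x + c)) = (LINT x|lborel. F x)" for c
  proof -
    have m: "F \<in> borel_measurable borel" "(+) c \<in> borel_measurable borel"
      using contF by (auto intro: borel_measurable_continuous_onI)
    show "integrable lborel (\<lambda>x. F (x + c))"
      using integrable_distr_eq[of "(+) c" lborel borel F] m intF
      by (simp add: lborel_distr_plus add.commute)
    show "(LINT x|lborel. F (x + c)) = (LINT x|lborel. F x)"
      using integral_distr[of "(+) c" lborel borel F] m
      by (simp add: lborel_distr_plus add.commute)
  qed
  have D0: "(LINT x|lborel. D k x) = 0" for k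
    unfolding D_def using trans[of "s k *\<^sub>R b"] intF by simp
  have "(\<lambda>k. LINT x|lborel. D k x) \<longlonglongrightarrow> (LINT x|lborel. F' x b)"
  proof (rule integral_dominated_convergence)
    let ?w = "\<lambda>x::'a. \<bar>B\<bar> * indicator (cball 0 (R + norm b)) x :: real"
    show "integrable lborel ?w"
      using emeasure_bounded_finite[of "cball 0 (R + norm b) :: 'a set"]
      by (intro integrable_mult_right integrable_real_indicator) simp_all
    show "(\<lambda>x. F' x b) \<in> borel_measurable lborel" 
      using cont by (simp add: borel_measurable_continuous_onI)
    show "D k \<in> borel_measurable lborel" for k
      unfolding D_def using trans(1)[of "s k *\<^sub>R b"] intF by measurable
    show "AE x in lborel. norm (D k x) \<le> ?w x" for k
    proof (rule AE_I2)
      fix x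
      obtain t where t: "0 \<le> t" "t \<le> s k" "D k x = F' (x + t *\<^sub>R b) b" using mvt by blast
      show "norm (D k x) \<le> ?w x"
      proof (cases "x \<in> cball 0 (R + norm b)")
        case True
        then show ?thesis using t B' by simp
      next
        case False
        have "norm (t *\<^sub>R b) \<le> norm b"
          using t s[of k] by (simp add: mult_left_le_one_le)
        moreover have "norm x \<le> norm (x + t *\<^sub>R b) + norm (t *\<^sub>R b)"
          by (metis add_diff_cancel_right' norm_triangle_ineq4)
        ultimately have "x + t *\<^sub>R b \<notin> K" using False R[of "x + t *\<^sub>R b"] by auto
        then show ?thesis using t F'0 by simp
      qed
    qed
  qed (use lim in simp)
  then show ?thesis by (simp add: D0 LIMSEQ_const_iff)
qed

lemma integral_lebesgue_on_compact_support:
  fixes h :: "'a::euclidean_space \<Rightarrow> real"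
  assumes "continuous_on UNIV h" "\<And>x. x \<notin> K \<Longrightarrow> h x = 0" "K \<subseteq> \<Omega>" "\<Omega> \<in> sets lebesgue"
  shows "integral\<^sup>L (lebesgue_on \<Omega>) h = integral\<^sup>L lborel h"
proof -
  have "(\<lambda>x. indicator \<Omega> x *\<^sub>R h x) = h"
    using assms(2,3) by (auto simp: indicator_def fun_eq_iff)
  then have "integral\<^sup>L (lebesgue_on \<Omega>) h = integral\<^sup>L lebesgue h"
    using assms(4) by (simp add: integral_restrict_space)
  also have "\<dots> = integral\<^sup>L lborel h"
    using assms(1) by (intro integral_completion) (simp add: borel_measurable_continuous_onI)
  finally show ?thesis .
qed

lemma integration_by_parts:
  fixes f g :: "'a::euclidean_space \<Rightarrow> real"
  assumes f: "\<And>x. (f has_derivative f' x) (at x)" "continuous_on UNIV (\<lambda>x. f' x b)"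
    and g: "\<And>x. (g has_derivative g' x) (at x)" "continuous_on UNIV (\<lambda>x. g' x b)"
    and K: "compact K" "K \<subseteq> \<Omega>" "\<And>x. x \<notin> K \<Longrightarrow> g x = 0" and \<Omega>: "\<Omega> \<in> sets lebesgue"
  shows "(LINT x|lebesgue_on \<Omega>. f x * g' x b) = - (LINT x|lebesgue_on \<Omega>. f' x b * g x)"
proof -
  have cf: "continuous_on UNIV f" and cg: "continuous_on UNIV g"
    using f g by (meson continuous_at_imp_continuous_on has_derivative_continuous)+
  have g'0: "g' x b = 0" if "x \<notin> K" for x
    by (rule derivative_eq_0_outside_support[OF g(1) compact_imp_closed[OF K(1)] K(3) that])
  have c1: "continuous_on UNIV (\<lambda>x. f x * g' x b)" and c2: "continuous_on UNIV (\<lambda>x. f' x b * g x)"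
    using cf cg f(2) g(2) by (auto intro: continuous_on_mult)
  have i1: "integrable lborel (\<lambda>x. f x * g' x b)" 
    by (rule integrable_lborel_compact_support[OF c1 K(1)]) (simp add: g'0)
  have i2: "integrable lborel (\<lambda>x. f' x b * g x)" 
    by (rule integrable_lborel_compact_support[OF c2 K(1)]) (simp add: K(3))
  have "(LINT x|lborel. (\<lambda>h. f x * g' x h + f' x h * g x) b) = 0"
  proof (rule integral_partial_derivative_eq_0[OF _ _ K(1)])
    show "((\<lambda>x. f x * g x) has_derivative (\<lambda>h. f x * g' x h + f' x h * g x)) (at x)" for x
      by (rule has_derivative_mult[OF f(1) g(1)])
    show "continuous_on UNIV (\<lambda>x. f x * g' x b + f' x b * g x)"
      using c1 c2 by (rule continuous_on_add)
  qed (simp add: K(3))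
  then have "(LINT x|lborel. f x * g' x b) = - (LINT x|lborel. f' x b * g x)"
    using i1 i2 by simp
  moreover have "(LINT x|lebesgue_on \<Omega>. f x * g' x b) = (LINT x|lborel. f x * g' x b)"
    by (rule integral_lebesgue_on_compact_support[OF c1 _ K(2) \<Omega>]) (simp add: g'0)
  moreover have "(LINT x|lebesgue_on \<Omega>. f' x b * g x) = (LINT x|lborel. f' x b * g x)"
    by (rule integral_lebesgue_on_compact_support[OF c2 _ K(2) \<Omega>]) (simp add: K(3))
  ultimately show ?thesis by simp
qed

lemma sq_integrable_continuous:
  fixes f :: "'a::euclidean_space \<Rightarrow> 'b::euclidean_space"
  assumes "continuous_on UNIV f" "bounded \<Omega>" "\<Omega> \<in> sets lebesgue"
  shows "sq_integrable (lebesgue_on \<Omega>) f"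
proof -
  obtain a where a: "\<Omega> \<subseteq> cbox (-a) a"
    using bounded_subset_cbox_symmetric[OF assms(2)] by blast
  have "f \<in> borel_measurable (lebesgue_on \<Omega>)"
    using assms by (intro measurable_restrict_space1 measurable_completion)
      (simp add: borel_measurable_continuous_onI)
  moreover have "set_integrable lebesgue (cbox (-a) a) (\<lambda>x. (norm (f x))\<^sup>2)"
    by (intro absolutely_integrable_continuous continuous_intros continuous_on_subset[OF assms(1)]) auto
  then have "set_integrable lebesgue \<Omega> (\<lambda>x. (norm (f x))\<^sup>2)"
    by (rule set_integrable_subset) (use assms a in auto)
  then have "integrable (lebesgue_on \<Omega>) (\<lambda>x. (norm (f x))\<^sup>2)"
    using assms(3) by (simp add: integrable_restrict_space set_integrable_def)
  ultimately show ?thesis by (simp add: sq_integrable_def)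
qed

section \<open>Existence of weak solutions\<close>

text \<open>
  The direct method for the energy \<open>Q u = a u u / 2 - L u\<close>, in a space that need not be complete, so
  that a sequence takes the place of a minimizer.  The value of \<open>Q\<close> at a midpoint bounds the distance
  of two almost minimizers, and almost minimality in direction \<open>w\<close> is an almost Euler-Lagrange
  equation.
\<close>

lemma minimizing_sequence:
  fixes S :: "('x \<Rightarrow> real) set" and a :: "('x \<Rightarrow> real) \<Rightarrow> ('x \<Rightarrow> real) \<Rightarrow> real"
  assumes ne: "S \<noteq> {}"
    and closed: "\<And>u v c. u \<in> S \<Longrightarrow> v \<in> S \<Longrightarrow> (\<lambda>x. u x + c * v x) \<in> S"
    and lin: "\<And>u v w c. u \<in> S \<Longrightarrow> v \<in> S \<Longrightarrow> w \<in> S \<Longrightarrow> a (\<lambda>x. u x + c * v x) w = a u w + c * a v w"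
    and sym: "\<And>u v. u \<in> S \<Longrightarrow> v \<in> S \<Longrightarrow> a u v = a v u"
    and pos: "\<And>u. u \<in> S \<Longrightarrow> a u u \<ge> 0"
    and linL: "\<And>u v c. u \<in> S \<Longrightarrow> v \<in> S \<Longrightarrow> L (\<lambda>x. u x + c * v x) = L u + c * L v"
    and bdd: "\<And>u. u \<in> S \<Longrightarrow> (L u)\<^sup>2 \<le> C * a u u"
  obtains v where "\<And>k::nat. v k \<in> S"
    and "\<And>e. e > 0 \<Longrightarrow> \<exists>N. \<forall>i\<ge>N. \<forall>j\<ge>N. a (\<lambda>x. v i x - v j x) (\<lambda>x. v i x - v j x) < e"
    and "\<And>w. w \<in> S \<Longrightarrow> (\<lambda>k. a (v k) w) \<longlonglongrightarrow> L w"
proof -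
  define Q where "Q u = a u u / 2 - L u" for u
  have expand: "Q (\<lambda>x. u x + t * w x) = Q u + t * (a u w - L w) + t\<^sup>2 / 2 * a w w"
    if "u \<in> S" "w \<in> S" for u w t
  proof -
    let ?z = "\<lambda>x. u x + t * w x"
    have z: "?z \<in> S" using that by (rule closed)
    have "a ?z ?z = a u ?z + t * a w ?z" by (rule lin[OF that z])
    also have "a u ?z = a u u + t * a u w"
      using sym[OF that(1) z] lin[OF that that(1)] sym[OF that] by simp
    also have "a w ?z = a u w + t * a w w"
      using sym[OF that(2) z] lin[OF that that(2)] by simp
    finally show ?thesis
      using linL[OF that] by (simp add: Q_def field_simps power2_eq_square)
  qed
  have lower: "- \<bar>C\<bar> / 2 \<le> Q u" if "u \<in> S" for u
  proof -
    have "C * a u u \<le> \<bar>C\<bar> * a u u" using pos[OF that] by (intro mult_right_mono) auto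
    also have "\<dots> \<le> ((\<bar>C\<bar> + a u u) / 2)\<^sup>2"
      using sum_squares_bound[of "\<bar>C\<bar>" "a u u"] by (simp add: power2_eq_square field_simps)
    finally have "(L u)\<^sup>2 \<le> ((\<bar>C\<bar> + a u u) / 2)\<^sup>2" using bdd[OF that] by linarith
    then have "L u \<le> (\<bar>C\<bar> + a u u) / 2"
      by (rule power2_le_imp_le) (use pos[OF that] in simp)
    then show ?thesis by (simp add: Q_def field_simps)
  qed
  define I where "I = (INF u\<in>S. Q u)"
  have bddb: "bdd_below (Q ` S)" using lower by (intro bdd_belowI2) auto
  have I_le: "I \<le> Q u" if "u \<in> S" for u
    unfolding I_def by (rule cINF_lower[OF bddb that])
  define \<epsilon> where "\<epsilon> k = inverse (real (Suc k))" for k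
  have eps: "\<epsilon> k > 0" for k by (simp add: \<epsilon>_def)
  have eps0: "\<epsilon> \<longlonglongrightarrow> 0" unfolding \<epsilon>_def by (rule LIMSEQ_inverse_real_of_nat)
  have "\<exists>u\<in>S. Q u < I + \<epsilon> k" for k
    using cINF_less_iff[OF ne bddb, of "I + \<epsilon> k"] eps[of k] unfolding I_def by simp
  then obtain v where v: "\<And>k. v k \<in> S" "\<And>k. Q (v k) < I + \<epsilon> k"
    by metis
  show thesis
  proof (rule that[of v])
    show "v k \<in> S" for k by (rule v)
  next
    fix e :: real assume "e > 0"
    have est: "a (\<lambda>x. v i x - v j x) (\<lambda>x. v i x - v j x) \<le> 4 * (\<epsilon> i + \<epsilon> j)" for i j
    proof -
      let ?w = "\<lambda>x. v i x + (-1) * v j x"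
      have w: "?w \<in> S" by (rule closed[OF v(1) v(1)])
      have "Q (v i) = Q (\<lambda>x. v j x + 1 * ?w x)" by simp
      also have "\<dots> = Q (v j) + (a (v j) ?w - L ?w) + a ?w ?w / 2"
        by (subst expand[OF v(1) w]) simp
      finally have 1: "Q (v i) = Q (v j) + (a (v j) ?w - L ?w) + a ?w ?w / 2" .
      have "I \<le> Q (\<lambda>x. v j x + (1/2) * ?w x)" by (rule I_le[OF closed[OF v(1) w]])
      also have "\<dots> = Q (v j) + (a (v j) ?w - L ?w) / 2 + a ?w ?w / 8"
        by (subst expand[OF v(1) w]) (simp add: power2_eq_square)
      finally have "a ?w ?w \<le> 4 * (\<epsilon> i + \<epsilon> j)" using 1 v(2)[of i] v(2)[of j] by argo
      then show ?thesis by simp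
    qed
    have "eventually (\<lambda>k. \<epsilon> k < e / 8) sequentially"
      using order_tendstoD(2)[OF eps0, of "e / 8"] \<open>e > 0\<close> by simp
    then obtain N where "\<And>k. k \<ge> N \<Longrightarrow> \<epsilon> k < e / 8" by (auto simp: eventually_sequentially)
    then have "a (\<lambda>x. v i x - v j x) (\<lambda>x. v i x - v j x) < e" if "i \<ge> N" "j \<ge> N" for i j
    proof -
      have "\<epsilon> i < e / 8" "\<epsilon> j < e / 8" using \<open>\<And>k. k \<ge> N \<Longrightarrow> \<epsilon> k < e / 8\<close> that by auto
      then have "4 * (\<epsilon> i + \<epsilon> j) < e" by argo
      with est[of i j] show ?thesis by (rule order_le_less_trans)
    qed
    then show "\<exists>N. \<forall>i\<ge>N. \<forall>j\<ge>N. a (\<lambda>x. v i x - v j x) (\<lambda>x. v i x - v j x) < e" by blast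
  next
    fix w assume w: "w \<in> S"
    let ?A = "a w w + 1"
    have A: "?A > 0" using pos[OF w] by simp
    have est: "(a (v k) w - L w)\<^sup>2 \<le> 2 * ?A * \<epsilon> k" for k
    proof -
      define d where "d = a (v k) w - L w"
      \<comment> \<open>Comparison of \<open>v k\<close> with \<open>v k - (d / ?A) * w\<close>; the summand 1 in \<open>?A\<close> covers the case \<open>a w w = 0\<close>.\<close>
      define X where "X = d\<^sup>2 / ?A"
      have "(- d / ?A)\<^sup>2 * a w w \<le> (- d / ?A)\<^sup>2 * ?A"
        by (intro mult_left_mono) auto
      moreover have X: "(- d / ?A)\<^sup>2 * ?A = X" "(- d / ?A) * d = - X"
        using A by (simp_all add: power2_eq_square X_def)
      moreover have "I \<le> Q (v k) + (- d / ?A) * d + (- d / ?A)\<^sup>2 / 2 * a w w"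
        using I_le[OF closed[OF v(1) w]] expand[OF v(1) w] unfolding d_def by metis
      ultimately have "I \<le> Q (v k) - X / 2" by argo
      then have "X \<le> 2 * \<epsilon> k" using v(2)[of k] by argo
      then have "d\<^sup>2 / ?A \<le> 2 * \<epsilon> k" by (simp add: X_def)
      then show ?thesis using A by (simp add: d_def field_simps)
    qed
    have "(\<lambda>k. (a (v k) w - L w)\<^sup>2) \<longlonglongrightarrow> 0"
    proof (rule tendsto_sandwich[OF always_eventually always_eventually tendsto_const])
      show "(\<lambda>k. 2 * ?A * \<epsilon> k) \<longlonglongrightarrow> 0"
        using tendsto_mult_right_zero[OF eps0] by blast
    qed (use est in auto)
    then show "(\<lambda>k. a (v k) w) \<longlonglongrightarrow> L w"
      by (simp add: LIM_zero_iff)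
  qed
qed

lemma set_lebesgue_integral_lebesgue_on:
  fixes f :: "'a::euclidean_space \<Rightarrow> 'b::euclidean_space"
  assumes "\<Omega> \<in> sets lebesgue"
  shows "(LINT x:\<Omega>|lebesgue. f x) = integral\<^sup>L (lebesgue_on \<Omega>) f"
  using assms by (simp add: set_lebesgue_integral_def integral_restrict_space)

lemma square_integrable_on_iff:
  assumes "\<Omega> \<in> sets lebesgue"
  shows "square_integrable_on \<Omega> f \<longleftrightarrow> sq_integrable (lebesgue_on \<Omega>) f"
  using assms by (simp add: square_integrable_on_def sq_integrable_def set_borel_measurable_def
      borel_measurable_restrict_space_iff set_integrable_def integrable_restrict_space)

abbreviation unit_ball_measure :: "'a::euclidean_space measure" where
  "unit_ball_measure \<equiv> lebesgue_on (ball 0 1)"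

lemma finite_unit_ball_measure: "finite_measure (unit_ball_measure :: 'a::euclidean_space measure)"
  using emeasure_bounded_finite[of "ball 0 1 :: 'a set"]
  by (intro finite_measureI) (simp add: emeasure_restrict_space space_restrict_space)

lemma sq_integrable_test_function:
  assumes "\<phi> \<in> test_functions \<Omega>"
  shows "sq_integrable unit_ball_measure \<phi>" "sq_integrable unit_ball_measure (gradient \<phi>)"
  using test_function_smooth[OF assms]
  by (auto intro!: sq_integrable_continuous smooth_continuous continuous_gradient)

text \<open>
  Integrating the derivative of \<open>(x \<bullet> b) * (\<phi> x)\<^sup>2\<close> in direction \<open>b\<close> gives
  \<open>\<integral> \<phi>\<^sup>2 = - 2 * \<integral> (x \<bullet> b) * \<phi> * \<partial>\<^sub>b\<phi>\<close>; the weight \<open>x \<bullet> b\<close> is at most 1 in the unit ball, and the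
  Cauchy-Schwarz inequality finishes.
\<close>

lemma poincare_inequality:
  fixes \<phi> :: "'a::euclidean_space \<Rightarrow> real"
  assumes \<phi>: "\<phi> \<in> test_functions (ball 0 1)"
  shows "(LINT x|unit_ball_measure. (\<phi> x)\<^sup>2) \<le> 4 * (LINT x|unit_ball_measure. (norm (gradient \<phi> x))\<^sup>2)"
proof -
  let ?M = "unit_ball_measure :: 'a measure"
  obtain b :: 'a where b: "b \<in> Basis" using nonempty_Basis by blast
  let ?D = "\<lambda>x. frechet_derivative \<phi> (at x)"
  let ?h = "\<lambda>x. (x \<bullet> b) * ?D x b"
  obtain K where K: "compact K" "K \<subseteq> ball 0 1" "\<And>x. x \<notin> K \<Longrightarrow> \<phi> x = 0"
    using test_function_support[OF \<phi>] by blast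
  have sm: "smooth \<phi>" using \<phi> by (rule test_function_smooth)
  have c: "continuous_on UNIV (\<lambda>x. ?D x b)" "continuous_on UNIV \<phi>"
    using smooth_continuous sm smooth_partial[OF sm b] by auto
  have L2: "sq_integrable ?M \<phi>" "sq_integrable ?M ?h"
    using c by (auto intro!: sq_integrable_continuous continuous_intros)
  have "(LINT x|?M. ((x \<bullet> b) * \<phi> x) * ?D x b) = - (LINT x|?M. (\<lambda>h. (x \<bullet> b) * ?D x h + (h \<bullet> b) * \<phi> x) b * \<phi> x)"
  proof (rule integration_by_parts[where f' = "\<lambda>x h. (x \<bullet> b) * ?D x h + (h \<bullet> b) * \<phi> x" and g' = ?D, OF _ _ _ _ K])
    show "((\<lambda>x. (x \<bullet> b) * \<phi> x) has_derivative (\<lambda>h. (x \<bullet> b) * ?D x h + (h \<bullet> b) * \<phi> x)) (at x)" for x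
      by (intro has_derivative_mult smooth_has_derivative[OF sm] has_derivative_inner_left has_derivative_ident)
    show "(\<phi> has_derivative ?D x) (at x)" for x by (rule smooth_has_derivative[OF sm])
  qed (use c in \<open>auto intro!: continuous_intros\<close>)
  then have "(LINT x|?M. \<phi> x \<bullet> ?h x) = - (LINT x|?M. \<phi> x \<bullet> ?h x + \<phi> x \<bullet> \<phi> x)"
    using b by (simp add: algebra_simps)
  also have "\<dots> = - (LINT x|?M. \<phi> x \<bullet> ?h x) - (LINT x|?M. \<phi> x \<bullet> \<phi> x)"
    using sq_integrable_inner[OF L2] sq_integrable_inner[OF L2(1) L2(1)]
    by (subst Bochner_Integration.integral_add) auto
  finally have P: "(LINT x|?M. (\<phi> x)\<^sup>2) = - 2 * (LINT x|?M. \<phi> x \<bullet> ?h x)"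
    by (simp add: power2_eq_square)
  define p where "p = (LINT x|?M. (\<phi> x)\<^sup>2)"
  define g where "g = (LINT x|?M. (norm (gradient \<phi> x))\<^sup>2)"
  have hle: "(LINT x|?M. (norm (?h x))\<^sup>2) \<le> g"
    unfolding g_def
  proof (rule integral_mono)
    show "integrable ?M (\<lambda>x. (norm (?h x))\<^sup>2)" "integrable ?M (\<lambda>x. (norm (gradient \<phi> x))\<^sup>2)"
      using L2(2) sq_integrable_test_function(2)[OF \<phi>] by (simp_all add: sq_integrable_def)
    fix x :: 'a assume "x \<in> space ?M"
    then have "norm x < 1" by (simp add: space_restrict_space)
    then have "\<bar>x \<bullet> b\<bar> \<le> 1" using Basis_le_norm[OF b, of x] by linarith
    then have "\<bar>?h x\<bar> \<le> \<bar>?D x b\<bar>" by (simp add: abs_mult mult_left_le_one_le)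
    also have "\<dots> \<le> norm (gradient \<phi> x)"
      using Basis_le_norm[OF b, of "gradient \<phi> x"] gradient_inner_Basis[OF b] by metis
    finally show "(norm (?h x))\<^sup>2 \<le> (norm (gradient \<phi> x))\<^sup>2" by (simp add: abs_le_square_iff[symmetric])
  qed
  have "p \<ge> 0" by (simp add: p_def)
  have "p\<^sup>2 = 4 * (LINT x|?M. \<phi> x \<bullet> ?h x)\<^sup>2"
    using P unfolding p_def by (simp add: power_mult_distrib)
  also have "\<dots> \<le> 4 * (p * (LINT x|?M. (norm (?h x))\<^sup>2))"
    using l2_Cauchy_Schwarz[OF L2] by (simp add: p_def)
  also have "\<dots> \<le> 4 * (p * g)"
    using hle \<open>p \<ge> 0\<close> by (intro mult_left_mono) auto
  finally have "p * p \<le> p * (4 * g)" by (simp add: power2_eq_square)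
  moreover have "g \<ge> 0" by (simp add: g_def)
  ultimately have "p \<le> 4 * g" using \<open>p \<ge> 0\<close> by (cases "p = 0") auto
  then show ?thesis by (simp add: p_def g_def)
qed

lemma test_function_integration_by_parts:
  fixes \<phi> \<psi> :: "'a::euclidean_space \<Rightarrow> real"
  assumes \<phi>: "smooth \<phi>" and \<psi>: "\<psi> \<in> test_functions \<Omega>" and b: "b \<in> Basis" and \<Omega>: "\<Omega> \<in> sets lebesgue"
  shows "(LINT x|lebesgue_on \<Omega>. \<phi> x * (gradient \<psi> x \<bullet> b)) = - (LINT x|lebesgue_on \<Omega>. (gradient \<phi> x \<bullet> b) * \<psi> x)"
proof -
  obtain K where K: "compact K" "K \<subseteq> \<Omega>" "\<And>x. x \<notin> K \<Longrightarrow> \<psi> x = 0"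
    using test_function_support[OF \<psi>] by blast
  have \<psi>': "smooth \<psi>" using \<psi> by (rule test_function_smooth)
  show ?thesis
    unfolding gradient_inner_Basis[OF b]
    by (rule integration_by_parts[OF _ _ _ _ K \<Omega>])
      (use smooth_has_derivative smooth_continuous[OF smooth_partial[OF _ b]] \<phi> \<psi>' in auto)
qed

text \<open>
  An almost minimizing sequence of test functions for the Dirichlet energy converges in the square
  mean together with its gradients.  The integration by parts and the almost Euler-Lagrange equation
  of its members pass to the limit.
\<close>

theorem weak_solution_exists:
  fixes f :: "'a::euclidean_space \<Rightarrow> real"
  assumes f: "sq_integrable unit_ball_measure f"
  shows "\<exists>u. weak_solution (ball 0 1) f u"
proof -
  let ?B = "ball 0 1 :: 'a set"
  let ?M = "unit_ball_measure :: 'a measure"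
  let ?S = "test_functions ?B"
  let ?a = "\<lambda>\<phi> \<psi>. LINT x|?M. gradient \<phi> x \<bullet> gradient \<psi> x"
  let ?L = "\<lambda>\<phi>. LINT x|?M. f x * \<phi> x"
  have B: "?B \<in> sets lebesgue" by simp
  note L2 = sq_integrable_test_function
  have aeq: "?a \<phi> \<phi> = (LINT x|?M. (norm (gradient \<phi> x))\<^sup>2)" for \<phi>
    by (simp add: power2_norm_eq_inner)
  obtain v where v: "\<And>k. v k \<in> ?S"
    and cauchy: "\<And>e. e > 0 \<Longrightarrow> \<exists>N. \<forall>i\<ge>N. \<forall>j\<ge>N. ?a (\<lambda>x. v i x - v j x) (\<lambda>x. v i x - v j x) < e"
    and lim: "\<And>w. w \<in> ?S \<Longrightarrow> (\<lambda>k. ?a (v k) w) \<longlonglongrightarrow> ?L w"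
  proof (rule minimizing_sequence[of ?S ?a ?L "4 * (LINT x|?M. (norm (f x))\<^sup>2)"])
    show "?S \<noteq> {}" using zero_test_function by blast
    show "(\<lambda>x. u x + c * w x) \<in> ?S" if "u \<in> ?S" "w \<in> ?S" for u w c
      using that by (rule test_functions_linear_combination)
    show "?a (\<lambda>x. u x + c * v x) w = ?a u w + c * ?a v w" if "u \<in> ?S" "v \<in> ?S" "w \<in> ?S" for u v w c
    proof -
      have "?a (\<lambda>x. u x + c * v x) w = (LINT x|?M. gradient u x \<bullet> gradient w x + c * (gradient v x \<bullet> gradient w x))"
        using that by (simp add: gradient_linear_combination[OF test_function_smooth test_function_smooth] inner_add_left)
      also have "\<dots> = ?a u w + c * ?a v w"
        using that by (simp add: sq_integrable_inner[OF L2(2) L2(2)])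
      finally show ?thesis .
    qed
    show "?a u v = ?a v u" for u v by (simp add: inner_commute)
    show "0 \<le> ?a u u" for u by simp
    show "?L (\<lambda>x. u x + c * v x) = ?L u + c * ?L v" if "u \<in> ?S" "v \<in> ?S" for u v c
    proof -
      have "?L (\<lambda>x. u x + c * v x) = (LINT x|?M. f x * u x + c * (f x * v x))"
        by (simp add: algebra_simps)
      also have "\<dots> = ?L u + c * ?L v"
        using sq_integrable_inner[OF f L2(1)[OF that(1)]] sq_integrable_inner[OF f L2(1)[OF that(2)]]
        by (subst Bochner_Integration.integral_add) auto
      finally show ?thesis .
    qed
    show "(?L u)\<^sup>2 \<le> 4 * (LINT x|?M. (norm (f x))\<^sup>2) * ?a u u" if "u \<in> ?S" for u
    proof -
      have "(?L u)\<^sup>2 \<le> (LINT x|?M. (norm (f x))\<^sup>2) * (LINT x|?M. (u x)\<^sup>2)"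
        using l2_Cauchy_Schwarz[OF f L2(1)[OF that]] by simp
      also have "\<dots> \<le> (LINT x|?M. (norm (f x))\<^sup>2) * (4 * ?a u u)"
        using poincare_inequality[OF that] by (intro mult_left_mono) (auto simp: power2_norm_eq_inner)
      finally show ?thesis by simp
    qed
  qed blast
  have diff: "(\<lambda>x. v i x - v j x) \<in> ?S" for i j
    using test_functions_linear_combination[OF v v, of i "-1" j] by simp
  have gdiff: "gradient (\<lambda>x. v i x - v j x) x = gradient (v i) x - gradient (v j) x" for i j x
    using gradient_linear_combination[OF test_function_smooth[OF v] test_function_smooth[OF v], of i "-1" j] by simp
  have da: "l2_dist_sq ?M (gradient (v i)) (gradient (v j)) = ?a (\<lambda>x. v i x - v j x) (\<lambda>x. v i x - v j x)" for i j
    by (simp add: l2_dist_sq_def gdiff power2_norm_eq_inner)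
  have dv: "l2_dist_sq ?M (v i) (v j) \<le> 4 * ?a (\<lambda>x. v i x - v j x) (\<lambda>x. v i x - v j x)" for i j
    using poincare_inequality[OF diff, of i j] by (simp add: aeq l2_dist_sq_def)
  obtain u where u: "sq_integrable ?M u" "(\<lambda>k. l2_dist_sq ?M (v k) u) \<longlonglongrightarrow> 0"
  proof (rule l2_complete[OF finite_unit_ball_measure L2(1)[OF v]])
    fix e :: real assume "e > 0"
    then obtain N where N: "\<forall>i\<ge>N. \<forall>j\<ge>N. ?a (\<lambda>x. v i x - v j x) (\<lambda>x. v i x - v j x) < e / 4"
      using cauchy[of "e / 4"] by auto
    have "l2_dist_sq ?M (v i) (v j) < e" if "i \<ge> N" "j \<ge> N" for i j
      using N[rule_format, OF that] dv[of i j] by linarith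
    then show "\<exists>N. \<forall>i\<ge>N. \<forall>j\<ge>N. l2_dist_sq ?M (v i) (v j) < e" by blast
  qed blast
  obtain g where g: "sq_integrable ?M g" "(\<lambda>k. l2_dist_sq ?M (gradient (v k)) g) \<longlonglongrightarrow> 0"
  proof (rule l2_complete[OF finite_unit_ball_measure L2(2)[OF v]])
    show "\<exists>N. \<forall>i\<ge>N. \<forall>j\<ge>N. l2_dist_sq ?M (gradient (v i)) (gradient (v j)) < e" if "e > 0" for e
      unfolding da using that by (rule cauchy)
  qed blast
  have weak: "has_weak_gradient ?B u g"
    unfolding has_weak_gradient_def square_integrable_on_iff[OF B] set_lebesgue_integral_lebesgue_on[OF B]
  proof (intro conjI ballI u(1) g(1))
    fix \<phi> and b :: 'a assume \<phi>: "\<phi> \<in> ?S" and b: "b \<in> Basis"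
    have "(\<lambda>k. LINT x|?M. v k x \<bullet> (gradient \<phi> x \<bullet> b)) \<longlonglongrightarrow> (LINT x|?M. u x \<bullet> (gradient \<phi> x \<bullet> b))"
      by (rule l2_tendsto_inner[OF L2(1)[OF v] u(1) sq_integrable_component[OF L2(2)[OF \<phi>]] u(2)])
    moreover have "(LINT x|?M. v k x \<bullet> (gradient \<phi> x \<bullet> b)) = - (LINT x|?M. gradient (v k) x \<bullet> (\<phi> x *\<^sub>R b))" for k
      using test_function_integration_by_parts[OF test_function_smooth[OF v] \<phi> b B, of k]
      by (simp add: mult.commute)
    moreover have "sq_integrable ?M (\<lambda>x. \<phi> x *\<^sub>R b)"
      using smooth_continuous[OF test_function_smooth[OF \<phi>]]
      by (auto intro!: sq_integrable_continuous continuous_intros)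
    from l2_tendsto_inner[OF L2(2)[OF v] g(1) this g(2)]
    have "(\<lambda>k. - (LINT x|?M. gradient (v k) x \<bullet> (\<phi> x *\<^sub>R b))) \<longlonglongrightarrow> - (LINT x|?M. g x \<bullet> (\<phi> x *\<^sub>R b))"
      by (rule tendsto_minus)
    ultimately have "(LINT x|?M. u x \<bullet> (gradient \<phi> x \<bullet> b)) = - (LINT x|?M. g x \<bullet> (\<phi> x *\<^sub>R b))"
      using LIMSEQ_unique by simp
    then show "(LINT x|?M. u x * (gradient \<phi> x \<bullet> b)) = - (LINT x|?M. (g x \<bullet> b) * \<phi> x)"
      by (simp add: mult.commute)
  qed
  have "(\<lambda>k. l2_dist_sq ?M (v k) u + l2_dist_sq ?M (gradient (v k)) g) \<longlonglongrightarrow> 0 + 0"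
    by (rule tendsto_add[OF u(2) g(2)])
  then have "u \<in> H10 ?B"
    unfolding H10_def set_lebesgue_integral_lebesgue_on[OF B] l2_dist_sq_def
    using weak v by auto
  moreover have "(LINT x|?M. g x \<bullet> gradient \<phi> x) = ?L \<phi>" if "\<phi> \<in> ?S" for \<phi>
    using l2_tendsto_inner[OF L2(2)[OF v] g(1) L2(2)[OF that] g(2)] lim[OF that] by (rule LIMSEQ_unique)
  ultimately have "weak_solution ?B f u"
    unfolding weak_solution_def set_lebesgue_integral_lebesgue_on[OF B] using weak by blast
  then show ?thesis by blast
qed

section \<open>Smooth approximations of the torsion function of the ball\<close>

text \<open>
  For positive \<open>\<delta>\<close> these functions vanish to infinite order at 0.  The powers of \<open>1 / t\<close> are included
  because they arise on differentiation: the derivative is a combination of those with larger \<open>m\<close>.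
\<close>

definition flat_exp :: "real \<Rightarrow> nat \<Rightarrow> real \<Rightarrow> real" where
  "flat_exp \<delta> m t = (if t \<le> 0 then 0 else (1 / t) ^ m * exp (- \<delta> / t))"

lemma flat_exp_tendsto_0:
  assumes "\<delta> > 0"
  shows "(flat_exp \<delta> m \<longlongrightarrow> 0) (at 0)"
proof (rule filterlim_split_at)
  show "(flat_exp \<delta> m \<longlongrightarrow> 0) (at_left 0)"
    by (rule tendsto_eventually) (auto simp: eventually_at_left_field flat_exp_def intro!: exI[of _ "-1"])
  have "((\<lambda>s::real. s ^ m / exp s) \<longlongrightarrow> 0) at_top"
    by (rule tendsto_power_div_exp_0)
  moreover have "filterlim (\<lambda>t. \<delta> * inverse t) at_top (at_right 0)"
    using assms by (intro filterlim_tendsto_pos_mult_at_top[OF tendsto_const _ filterlim_inverse_at_top_right])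
  ultimately have "((\<lambda>t. (\<delta> * inverse t) ^ m / exp (\<delta> * inverse t)) \<longlongrightarrow> 0) (at_right 0)"
    by (rule filterlim_compose)
  then have "((\<lambda>t. (1 / \<delta> ^ m) * ((\<delta> * inverse t) ^ m / exp (\<delta> * inverse t))) \<longlongrightarrow> 0) (at_right 0)"
    by (rule tendsto_mult_right_zero)
  moreover have "eventually (\<lambda>t. (1 / \<delta> ^ m) * ((\<delta> * inverse t) ^ m / exp (\<delta> * inverse t)) = flat_exp \<delta> m t) (at_right 0)"
    using assms by (intro eventually_at_rightI[of 0 1])
      (auto simp: flat_exp_def power_mult_distrib exp_minus field_simps)
  ultimately show "(flat_exp \<delta> m \<longlongrightarrow> 0) (at_right 0)"
    by (rule Lim_transform_eventually)
qed

lemma flat_exp_DERIV: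
  assumes "\<delta> > 0"
  shows "(flat_exp \<delta> m has_real_derivative
           (\<delta> * flat_exp \<delta> (m + 2) t - real m * flat_exp \<delta> (m + 1) t)) (at t)"
proof -
  consider "t > 0" | "t < 0" | "t = 0" by linarith
  then show ?thesis
  proof cases
    case 1
    have inv: "((\<lambda>t. 1 / t) has_real_derivative - ((1 / t)\<^sup>2)) (at t)"
      using 1 by (auto intro!: derivative_eq_intros simp: power2_eq_square)
    have pow: "((\<lambda>t. (1 / t) ^ m) has_real_derivative - (real m * (1 / t) ^ (m + 1))) (at t)"
      using DERIV_power[OF inv, of m] by (cases m) (simp_all add: power2_eq_square mult.assoc)
    have exp: "((\<lambda>t. exp (- \<delta> / t)) has_real_derivative exp (- \<delta> / t) * (\<delta> * (1 / t)\<^sup>2)) (at t)"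
      using 1 by (auto intro!: derivative_eq_intros simp: power2_eq_square)
    have "((\<lambda>t. (1 / t) ^ m * exp (- \<delta> / t)) has_real_derivative
        (\<delta> * flat_exp \<delta> (m + 2) t - real m * flat_exp \<delta> (m + 1) t)) (at t)"
      using DERIV_mult[OF pow exp] 1 by (simp add: flat_exp_def power2_eq_square algebra_simps)
    then show ?thesis
      by (rule has_field_derivative_transform_within_open[of _ _ _ "{0<..}"])
        (use 1 in \<open>auto simp: flat_exp_def\<close>)
  next
    case 2
    have "((\<lambda>t. 0) has_real_derivative 0) (at t)" by simp
    then have "(flat_exp \<delta> m has_real_derivative 0) (at t)"
      by (rule has_field_derivative_transform_within_open[of _ _ _ "{..<0}"])
        (use 2 in \<open>auto simp: flat_exp_def\<close>)
    with 2 show ?thesis by (simp add: flat_exp_def)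
  next
    case 3
    have "(\<lambda>h. (flat_exp \<delta> m (0 + h) - flat_exp \<delta> m 0) / h) = flat_exp \<delta> (m + 1)"
      by (auto simp: flat_exp_def fun_eq_iff)
    then have "(flat_exp \<delta> m has_real_derivative 0) (at 0)"
      unfolding DERIV_def using flat_exp_tendsto_0[OF assms] by simp
    with 3 show ?thesis by (simp add: flat_exp_def)
  qed
qed

text \<open>
  Compositions of the flat functions with \<open>c - (norm x)\<^sup>2\<close>, multiplied by polynomials.  This class is
  closed under partial derivatives, which makes all its members smooth at once.
\<close>

inductive_set flat_radial :: "real \<Rightarrow> real \<Rightarrow> ('a::euclidean_space \<Rightarrow> real) set" for \<delta> c where
  base: "(\<lambda>x. flat_exp \<delta> m (c - (norm x)\<^sup>2)) \<in> flat_radial \<delta> c"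
| add: "f \<in> flat_radial \<delta> c \<Longrightarrow> g \<in> flat_radial \<delta> c \<Longrightarrow> (\<lambda>x. f x + g x) \<in> flat_radial \<delta> c"
| scale: "f \<in> flat_radial \<delta> c \<Longrightarrow> (\<lambda>x. r * f x) \<in> flat_radial \<delta> c"
| coord: "f \<in> flat_radial \<delta> c \<Longrightarrow> (\<lambda>x. (x \<bullet> b) * f x) \<in> flat_radial \<delta> c"

lemma flat_radial_derivative:
  assumes "\<delta> > 0" "f \<in> flat_radial \<delta> c"
  shows "\<exists>f'. (\<forall>x. (f has_derivative f' x) (at x)) \<and> (\<forall>b. (\<lambda>x. f' x b) \<in> flat_radial \<delta> c)"
  using assms(2)
proof induction
  case (base m)
  let ?d = "\<lambda>t. \<delta> * flat_exp \<delta> (m + 2) t - real m * flat_exp \<delta> (m + 1) t"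
  let ?f' = "\<lambda>x h. - (2 * (x \<bullet> h)) * ?d (c - (norm x)\<^sup>2)"
  have "((\<lambda>x::'a. flat_exp \<delta> m (c - (norm x)\<^sup>2)) has_derivative ?f' x) (at x)" for x
  proof -
    have "((\<lambda>x::'a. c - (norm x)\<^sup>2) has_derivative (\<lambda>h. - (2 * (x \<bullet> h)))) (at x)"
      unfolding power2_norm_eq_inner
      by (auto intro!: derivative_eq_intros simp: inner_commute)
    from DERIV_compose_FDERIV[OF flat_exp_DERIV[OF assms(1)] this]
    show ?thesis by simp
  qed
  moreover have "(\<lambda>x. ?f' x b) \<in> flat_radial \<delta> c" for b
  proof -
    have "(\<lambda>x. (x \<bullet> b) * ((- 2 * \<delta>) * flat_exp \<delta> (m + 2) (c - (norm x)\<^sup>2)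
        + (2 * real m) * flat_exp \<delta> (m + 1) (c - (norm x)\<^sup>2))) \<in> flat_radial \<delta> c"
      by (intro flat_radial.intros)
    then show ?thesis by (simp add: algebra_simps)
  qed
  ultimately show ?case by (intro exI[of _ ?f'] conjI allI)
next
  case (add f g)
  then obtain f' g' where f': "\<And>x. (f has_derivative f' x) (at x)" "\<And>b. (\<lambda>x. f' x b) \<in> flat_radial \<delta> c"
    and g': "\<And>x. (g has_derivative g' x) (at x)" "\<And>b. (\<lambda>x. g' x b) \<in> flat_radial \<delta> c" by metis
  then show ?case
    by (intro exI[of _ "\<lambda>x h. f' x h + g' x h"]) (auto intro: has_derivative_add flat_radial.add)
next
  case (scale f r)
  then obtain f' where f': "\<And>x. (f has_derivative f' x) (at x)" "\<And>b. (\<lambda>x. f' x b) \<in> flat_radial \<delta> c"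
    by metis
  then show ?case
    by (intro exI[of _ "\<lambda>x h. r * f' x h"]) (auto intro: has_derivative_mult_right flat_radial.scale)
next
  case (coord f e)
  then obtain f' where f': "\<And>x. (f has_derivative f' x) (at x)" "\<And>b. (\<lambda>x. f' x b) \<in> flat_radial \<delta> c"
    by metis
  have "((\<lambda>x. (x \<bullet> e) * f x) has_derivative (\<lambda>h. (x \<bullet> e) * f' x h + (h \<bullet> e) * f x)) (at x)" for x
    by (intro has_derivative_mult f' has_derivative_inner_left has_derivative_ident)
  moreover have "(\<lambda>x. (x \<bullet> e) * f' x b + (b \<bullet> e) * f x) \<in> flat_radial \<delta> c" for b
    by (intro flat_radial.intros f' coord.hyps)
  ultimately show ?case
    by (intro exI[of _ "\<lambda>x h. (x \<bullet> e) * f' x h + (h \<bullet> e) * f x"] conjI allI)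
qed

lemma flat_radial_smooth:
  assumes "\<delta> > 0" "f \<in> flat_radial \<delta> c"
  shows "smooth f"
proof -
  have "Ck k f" for k
    using assms(2)
  proof (induction k arbitrary: f)
    case 0
    then have "\<forall>x. f differentiable (at x)"
      using flat_radial_derivative[OF assms(1)] by (metis differentiableI)
    then show ?case
      by (simp add: continuous_on_eq_continuous_at differentiable_imp_continuous_within)
  next
    case (Suc k)
    obtain f' where f': "\<And>x. (f has_derivative f' x) (at x)" "\<And>b. (\<lambda>x. f' x b) \<in> flat_radial \<delta> c"
      using flat_radial_derivative[OF assms(1) Suc.prems] by metis
    have "frechet_derivative f (at x) b = f' x b" for x b
      by (rule frechet_derivative_eqI[OF f'(1)])
    then show ?case using f' Suc.IH by (auto intro: differentiableI)
  qed
  then show ?thesis by (simp add: smooth_def)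
qed

lemma flat_radial_sum:
  assumes "finite A" "A \<noteq> {}" "\<And>a. a \<in> A \<Longrightarrow> f a \<in> flat_radial \<delta> c"
  shows "(\<lambda>x. \<Sum>a\<in>A. f a x) \<in> flat_radial \<delta> c"
  using assms by (induction rule: finite_ne_induct) (auto intro: flat_radial.add)

text \<open>
  The solution of \<open>- \<Delta> w = 1\<close> in the unit ball that vanishes on the unit sphere.
\<close>

definition ball_torsion :: "'a::euclidean_space \<Rightarrow> real" where
  "ball_torsion x = (1 - (norm x)\<^sup>2) / (2 * DIM('a))"

definition ball_torsion_gradient :: "'a::euclidean_space \<Rightarrow> 'a" where
  "ball_torsion_gradient x = (- 1 / DIM('a)) *\<^sub>R x"

definition cutoff :: "nat \<Rightarrow> real" where
  "cutoff k = inverse (real (Suc (Suc k)))"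

text \<open>
  This is \<open>\<theta> (c - (norm x)\<^sup>2) / (2 * n)\<close> with \<open>\<theta> t = t * exp (- \<delta> / t)\<close> for positive \<open>t\<close> and \<open>\<theta> t = 0\<close>
  otherwise, \<open>\<delta> = cutoff k\<close> and \<open>c = 1 - \<delta>\<close>.  Shifting by \<open>\<delta>\<close> keeps the support inside the open
  ball; the exponential factor makes the function smooth and tends to 1.
\<close>

definition approx_torsion :: "nat \<Rightarrow> 'a::euclidean_space \<Rightarrow> real" where
  "approx_torsion k x = 1 / (2 * DIM('a)) *
     ((1 - cutoff k - (norm x)\<^sup>2) * flat_exp (cutoff k) 0 (1 - cutoff k - (norm x)\<^sup>2))"

lemma cutoff: "0 < cutoff k" "cutoff k < 1"
  by (simp_all add: cutoff_def inverse_less_1_iff)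

lemma cutoff_tendsto: "cutoff \<longlonglongrightarrow> 0"
  unfolding cutoff_def using LIMSEQ_Suc[OF LIMSEQ_inverse_real_of_nat] .

lemma approx_torsion_support:
  assumes "x \<notin> cball (0::'a::euclidean_space) (sqrt (1 - cutoff k))"
  shows "approx_torsion k x = 0"
proof -
  have "sqrt (1 - cutoff k) < norm x" using assms by simp
  then have "1 - cutoff k < (norm x)\<^sup>2"
    using cutoff[of k] by (metis real_sqrt_less_iff real_sqrt_unique norm_ge_zero)
  then show ?thesis by (simp add: approx_torsion_def flat_exp_def)
qed

lemma cball_cutoff_subset: "cball (0::'a::euclidean_space) (sqrt (1 - cutoff k)) \<subseteq> ball 0 1"
  using cutoff[of k] by (auto simp: le_less_trans)

lemma approx_torsion_test_function:
  "(approx_torsion k :: 'a::euclidean_space \<Rightarrow> real) \<in> test_functions (ball 0 1)"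
proof (rule test_functionI[OF _ compact_cball cball_cutoff_subset approx_torsion_support])
  let ?c = "1 - cutoff k"
  let ?F = "\<lambda>x::'a. flat_exp (cutoff k) 0 (?c - (norm x)\<^sup>2)"
  have "(\<lambda>x. (1 / (2 * DIM('a))) * (?c * ?F x + (-1) * (\<Sum>b\<in>Basis. (x \<bullet> b) * ((x \<bullet> b) * ?F x))))
      \<in> flat_radial (cutoff k) ?c"
    by (intro flat_radial.scale flat_radial.add flat_radial_sum flat_radial.coord flat_radial.base) auto
  moreover have "(\<Sum>b\<in>Basis. (x \<bullet> b) * ((x \<bullet> b) * ?F x)) = (norm x)\<^sup>2 * ?F x" for x :: 'a
    by (simp only: power2_norm_eq_inner euclidean_inner[of x x] sum_distrib_right mult.assoc)
  ultimately have "(approx_torsion k :: 'a \<Rightarrow> real) \<in> flat_radial (cutoff k) ?c"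
    by (simp add: approx_torsion_def[abs_def] algebra_simps)
  then show "smooth (approx_torsion k :: 'a \<Rightarrow> real)"
    by (rule flat_radial_smooth[OF cutoff(1)])
qed

lemma approx_torsion_partial_test_function:
  assumes "b \<in> Basis"
  shows "(\<lambda>x. gradient (approx_torsion k) x \<bullet> b) \<in> test_functions (ball (0::'a::euclidean_space) 1)"
  unfolding gradient_inner_Basis[OF assms]
proof (rule test_functionI[OF _ compact_cball cball_cutoff_subset])
  have sm: "smooth (approx_torsion k :: 'a \<Rightarrow> real)"
    by (rule test_function_smooth[OF approx_torsion_test_function])
  show "smooth (\<lambda>x::'a. frechet_derivative (approx_torsion k) (at x) b)"
    by (rule smooth_partial[OF sm assms])
  show "frechet_derivative (approx_torsion k) (at x) b = 0"
    if "x \<notin> cball (0::'a) (sqrt (1 - cutoff k))" for x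
    by (rule derivative_eq_0_outside_support[OF smooth_has_derivative[OF sm] closed_cball approx_torsion_support that])
qed

text \<open>
  The derivative of \<open>\<theta> t = t * exp (- \<delta> / t)\<close>, extended by zero: the factor by which the gradient of
  the approximation differs from that of the torsion.
\<close>

definition damping :: "real \<Rightarrow> real \<Rightarrow> real" where
  "damping \<delta> t = flat_exp \<delta> 0 t + \<delta> * t * flat_exp \<delta> 2 t"

lemma gradient_approx_torsion:
  "gradient (approx_torsion k) x = damping (cutoff k) (1 - cutoff k - (norm x)\<^sup>2) *\<^sub>R ball_torsion_gradient (x::'a::euclidean_space)"
proof (rule euclidean_eqI)
  fix b :: 'a assume b: "b \<in> Basis"
  let ?d = "cutoff k"
  let ?t = "\<lambda>x::'a. 1 - ?d - (norm x)\<^sup>2"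
  have t: "(?t has_derivative (\<lambda>h. - (2 * (x \<bullet> h)))) (at x)"
    unfolding power2_norm_eq_inner
    by (auto intro!: derivative_eq_intros simp: inner_commute)
  have F: "((\<lambda>x. flat_exp ?d 0 (?t x)) has_derivative (\<lambda>h. - (2 * (x \<bullet> h)) * (?d * flat_exp ?d 2 (?t x)))) (at x)"
    using DERIV_compose_FDERIV[OF flat_exp_DERIV[OF cutoff(1), of k 0] t] by (simp add: numeral_2_eq_2)
  have "(approx_torsion k has_derivative (\<lambda>h. 1 / (2 * DIM('a)) *
      (?t x * (- (2 * (x \<bullet> h)) * (?d * flat_exp ?d 2 (?t x))) + - (2 * (x \<bullet> h)) * flat_exp ?d 0 (?t x)))) (at x)"
    unfolding approx_torsion_def[abs_def]
    by (intro has_derivative_mult_right has_derivative_mult t F)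
  from frechet_derivative_eqI[OF this, of b]
  show "gradient (approx_torsion k) x \<bullet> b = (damping ?d (?t x) *\<^sub>R ball_torsion_gradient x) \<bullet> b"
    unfolding gradient_inner_Basis[OF b]
    by (simp add: damping_def ball_torsion_gradient_def algebra_simps add_divide_distrib)
qed

lemma damping_eq: "t > 0 \<Longrightarrow> damping \<delta> t = (1 + \<delta> / t) * exp (- (\<delta> / t))"
  by (simp add: damping_def flat_exp_def power2_eq_square field_simps)

text \<open>
  With \<open>y = \<delta> / t\<close> the upper bound reads \<open>1 + y \<le> exp y\<close>.
\<close>

lemma damping_bounds:
  assumes "\<delta> > 0"
  shows "0 \<le> damping \<delta> t" "damping \<delta> t \<le> 1"
proof -
  have "(1 + \<delta> / t) * exp (- (\<delta> / t)) \<le> exp (\<delta> / t) * exp (- (\<delta> / t))"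
    by (intro mult_right_mono) auto
  then have "(1 + \<delta> / t) * exp (- (\<delta> / t)) \<le> 1" by (simp add: exp_minus)
  then show "damping \<delta> t \<le> 1" using damping_eq[of t \<delta>] by (cases "t > 0") (auto simp: damping_def flat_exp_def)
  show "0 \<le> damping \<delta> t" using assms by (auto simp: damping_def flat_exp_def)
qed

lemma approximation_pointwise:
  fixes x :: "'a::euclidean_space"
  assumes "norm x < 1"
  shows "(\<lambda>k. approx_torsion k x) \<longlonglongrightarrow> ball_torsion x"
    and "(\<lambda>k. damping (cutoff k) (1 - cutoff k - (norm x)\<^sup>2)) \<longlonglongrightarrow> 1"
proof -
  let ?t = "\<lambda>k. 1 - cutoff k - (norm x)\<^sup>2"
  let ?s = "1 - (norm x)\<^sup>2"
  have s: "?s > 0" using assms by (simp add: power_less_one_iff abs_square_less_1)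
  have t: "?t \<longlonglongrightarrow> ?s"
    using tendsto_diff[OF tendsto_diff[OF tendsto_const cutoff_tendsto] tendsto_const, of 1 "(norm x)\<^sup>2"] by simp
  have pos: "eventually (\<lambda>k. ?t k > 0) sequentially" by (rule order_tendstoD(1)[OF t s])
  have q: "(\<lambda>k. cutoff k / ?t k) \<longlonglongrightarrow> 0 / ?s"
    by (rule tendsto_divide[OF cutoff_tendsto t]) (use s in simp)
  have "(\<lambda>k. 1 / (2 * DIM('a)) * (?t k * exp (- (cutoff k / ?t k)))) \<longlonglongrightarrow> 1 / (2 * DIM('a)) * (?s * exp (- (0 / ?s)))"
    by (intro tendsto_mult tendsto_const t tendsto_exp tendsto_minus q)
  moreover have "eventually (\<lambda>k. 1 / (2 * DIM('a)) * (?t k * exp (- (cutoff k / ?t k))) = approx_torsion k x) sequentially"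
    using pos by eventually_elim (simp add: approx_torsion_def flat_exp_def)
  ultimately show "(\<lambda>k. approx_torsion k x) \<longlonglongrightarrow> ball_torsion x"
    using Lim_transform_eventually by (fastforce simp: ball_torsion_def)
  have "(\<lambda>k. (1 + cutoff k / ?t k) * exp (- (cutoff k / ?t k))) \<longlonglongrightarrow> (1 + 0 / ?s) * exp (- (0 / ?s))"
    by (intro tendsto_mult tendsto_add tendsto_const tendsto_exp tendsto_minus q)
  moreover have "eventually (\<lambda>k. (1 + cutoff k / ?t k) * exp (- (cutoff k / ?t k)) = damping (cutoff k) (?t k)) sequentially"
    using pos by eventually_elim (simp add: damping_eq)
  ultimately show "(\<lambda>k. damping (cutoff k) (?t k)) \<longlonglongrightarrow> 1"
    using Lim_transform_eventually by fastforce
qed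

lemma approx_torsion_le_1: "\<bar>approx_torsion k (x::'a::euclidean_space)\<bar> \<le> 1"
proof (cases "1 - cutoff k - (norm x)\<^sup>2 \<le> 0")
  case True
  then show ?thesis by (simp add: approx_torsion_def flat_exp_def)
next
  case False
  let ?t = "1 - cutoff k - (norm x)\<^sup>2"
  have t: "0 < ?t" "?t \<le> 1" using False cutoff[of k] zero_le_power2[of "norm x"] by linarith+
  have "cutoff k / ?t > 0" using t cutoff[of k] by simp
  then have e: "exp (- cutoff k / ?t) \<le> 1" by simp
  have d: "1 / (2 * real DIM('a)) \<le> 1"
  proof -
    have "1 \<le> real DIM('a)" using DIM_ge_Suc0[where 'a='a] by linarith
    then show ?thesis by (subst divide_le_eq_1_pos) linarith+
  qed
  have "1 / (2 * real DIM('a)) * (?t * exp (- cutoff k / ?t)) \<le> 1 * (1 * 1)"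
    using t e d by (intro mult_mono) auto
  moreover have "0 \<le> 1 / (2 * real DIM('a)) * (?t * exp (- cutoff k / ?t))"
    using t by (intro mult_nonneg_nonneg) auto
  ultimately show ?thesis using t by (simp add: approx_torsion_def flat_exp_def)
qed

section \<open>The torsion functional as an integral over the set\<close>

lemma continuous_ball_torsion_gradient: "continuous_on UNIV (ball_torsion_gradient :: 'a::euclidean_space \<Rightarrow> 'a)"
  unfolding ball_torsion_gradient_def by (intro continuous_intros)

lemma approx_gradient_tendsto:
  "(\<lambda>k. l2_dist_sq unit_ball_measure (gradient (approx_torsion k)) (ball_torsion_gradient :: 'a::euclidean_space \<Rightarrow> 'a)) \<longlonglongrightarrow> 0"
proof -
  let ?M = "unit_ball_measure :: 'a measure"
  interpret finite_measure ?M by (rule finite_unit_ball_measure)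
  have meas: "gradient (approx_torsion k) \<in> borel_measurable ?M" "ball_torsion_gradient \<in> borel_measurable ?M" for k
    using sq_integrable_test_function(2)[OF approx_torsion_test_function, of k]
      sq_integrable_continuous[OF continuous_ball_torsion_gradient, of "ball 0 1"]
    by (auto simp: sq_integrable_def)
  have "(\<lambda>k. LINT x|?M. (norm (gradient (approx_torsion k) x - ball_torsion_gradient x))\<^sup>2) \<longlonglongrightarrow> (LINT x|?M. 0)"
  proof (rule integral_dominated_convergence[where w = "\<lambda>_. 1"])
    show "(\<lambda>x. (norm (gradient (approx_torsion k) x - ball_torsion_gradient x))\<^sup>2) \<in> borel_measurable ?M" for k
      using meas by auto
    have eq: "norm (gradient (approx_torsion k) x - ball_torsion_gradient x)
        = \<bar>damping (cutoff k) (1 - cutoff k - (norm x)\<^sup>2) - 1\<bar> * (norm x / DIM('a))" for k and x :: 'a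
    proof -
      have "gradient (approx_torsion k) x - ball_torsion_gradient x
        = (damping (cutoff k) (1 - cutoff k - (norm x)\<^sup>2) - 1) *\<^sub>R ball_torsion_gradient x"
        by (simp add: gradient_approx_torsion algebra_simps)
      then show ?thesis by (simp add: ball_torsion_gradient_def)
    qed
    show "AE x in ?M. (\<lambda>k. (norm (gradient (approx_torsion k) x - ball_torsion_gradient x))\<^sup>2) \<longlonglongrightarrow> 0"
    proof (rule AE_I2)
      fix x assume "x \<in> space ?M"
      then have "norm x < 1" by (simp add: space_restrict_space)
      have "(\<lambda>k. (\<bar>damping (cutoff k) (1 - cutoff k - (norm x)\<^sup>2) - 1\<bar> * (norm x / DIM('a)))\<^sup>2)
          \<longlonglongrightarrow> (\<bar>1 - 1\<bar> * (norm x / DIM('a)))\<^sup>2"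
        by (intro tendsto_intros approximation_pointwise \<open>norm x < 1\<close>)
      then show "(\<lambda>k. (norm (gradient (approx_torsion k) x - ball_torsion_gradient x))\<^sup>2) \<longlonglongrightarrow> 0"
        by (simp add: eq)
    qed
    show "AE x in ?M. norm ((norm (gradient (approx_torsion k) x - ball_torsion_gradient x))\<^sup>2) \<le> 1" for k
    proof (rule AE_I2)
      fix x assume "x \<in> space ?M"
      then have "norm x < 1" by (simp add: space_restrict_space)
      have "\<bar>damping (cutoff k) (1 - cutoff k - (norm x)\<^sup>2) - 1\<bar> \<le> 1"
        using damping_bounds[OF cutoff(1)[of k], of "1 - cutoff k - (norm x)\<^sup>2"] by linarith
      moreover have dim_ge_1: "1 \<le> real DIM('a)" using DIM_ge_Suc0[where 'a='a] by linarith
      have "norm x / DIM('a) \<le> 1"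
        using \<open>norm x < 1\<close> dim_ge_1 by (subst divide_le_eq_1_pos) linarith+
      ultimately have "norm (gradient (approx_torsion k) x - ball_torsion_gradient x) \<le> 1 * 1"
        unfolding eq by (intro mult_mono) auto
      then show "norm ((norm (gradient (approx_torsion k) x - ball_torsion_gradient x))\<^sup>2) \<le> 1"
        by (simp add: power_le_one)
    qed
  qed auto
  then show ?thesis by (simp add: l2_dist_sq_def)
qed

lemma approx_torsion_integral_tendsto:
  fixes f :: "'a::euclidean_space \<Rightarrow> real"
  assumes f: "integrable unit_ball_measure f"
  shows "(\<lambda>k. LINT x|unit_ball_measure. f x * approx_torsion k x) \<longlonglongrightarrow> (LINT x|unit_ball_measure. f x * ball_torsion x)"
proof (rule integral_dominated_convergence[where w = "\<lambda>x. \<bar>f x\<bar>"])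
  let ?M = "unit_ball_measure :: 'a measure"
  have "continuous_on UNIV (ball_torsion :: 'a \<Rightarrow> real)"
    unfolding ball_torsion_def by (intro continuous_intros) auto
  then have "(ball_torsion :: 'a \<Rightarrow> real) \<in> borel_measurable ?M"
    using sq_integrable_continuous[of ball_torsion "ball (0::'a) 1"] by (auto simp: sq_integrable_def)
  then show "(\<lambda>x. f x * ball_torsion x) \<in> borel_measurable ?M"
    using borel_measurable_integrable[OF f] by (intro borel_measurable_times)
  show "(\<lambda>x. f x * approx_torsion k x) \<in> borel_measurable ?M" for k
    using borel_measurable_integrable[OF f]
      sq_integrable_test_function(1)[OF approx_torsion_test_function[where 'a = 'a], of k]
    by (intro borel_measurable_times) (simp_all add: sq_integrable_def)
  show "integrable ?M (\<lambda>x. \<bar>f x\<bar>)" using f by simp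
  show "AE x in ?M. (\<lambda>k. f x * approx_torsion k x) \<longlonglongrightarrow> f x * ball_torsion x"
  proof (rule AE_I2)
    fix x assume "x \<in> space ?M"
    then have "norm x < 1" by (simp add: space_restrict_space)
    then show "(\<lambda>k. f x * approx_torsion k x) \<longlonglongrightarrow> f x * ball_torsion x"
      by (intro tendsto_mult tendsto_const approximation_pointwise)
  qed
  show "AE x in ?M. norm (f x * approx_torsion k x) \<le> \<bar>f x\<bar>" for k
    by (intro AE_I2) (simp add: abs_mult mult_right_le_one_le approx_torsion_le_1)
qed

text \<open>
  This is the equation \<open>- \<Delta> w = 1\<close> for the torsion \<open>w\<close> of the ball, tested with \<open>\<phi>\<close>: integration by
  parts moves the derivatives from \<open>\<phi>\<close> to the coordinate functions in \<open>\<nabla>w = - x / n\<close>.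
\<close>

lemma integral_test_function_eq:
  fixes \<phi> :: "'a::euclidean_space \<Rightarrow> real"
  assumes \<phi>: "\<phi> \<in> test_functions (ball 0 1)"
  shows "(LINT x|unit_ball_measure. gradient \<phi> x \<bullet> ball_torsion_gradient x) = (LINT x|unit_ball_measure. \<phi> x)"
proof -
  let ?M = "unit_ball_measure :: 'a measure"
  obtain K where K: "compact K" "K \<subseteq> ball 0 1" "\<And>x. x \<notin> K \<Longrightarrow> \<phi> x = 0"
    using test_function_support[OF \<phi>] by blast
  have sm: "smooth \<phi>" using \<phi> by (rule test_function_smooth)
  have part: "(LINT x|?M. (x \<bullet> b) * (gradient \<phi> x \<bullet> b)) = - (LINT x|?M. \<phi> x)" if b: "b \<in> Basis" for b
  proof -
    have "(LINT x|?M. (x \<bullet> b) * (frechet_derivative \<phi> (at x)) b) = - (LINT x|?M. (b \<bullet> b) * \<phi> x)"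
    proof (rule integration_by_parts[where f' = "\<lambda>x h. h \<bullet> b" and g' = "\<lambda>x. frechet_derivative \<phi> (at x)", OF _ _ _ _ K])
      show "((\<lambda>x. x \<bullet> b) has_derivative (\<lambda>h. h \<bullet> b)) (at x)" for x
        by (intro has_derivative_inner_left has_derivative_ident)
      show "(\<phi> has_derivative frechet_derivative \<phi> (at x)) (at x)" for x
        by (rule smooth_has_derivative[OF sm])
    qed (use smooth_continuous[OF smooth_partial[OF sm b]] in auto)
    then show ?thesis using b by (simp add: gradient_inner_Basis)
  qed
  have L2: "sq_integrable ?M (\<lambda>x. x \<bullet> b)" for b
    by (intro sq_integrable_continuous continuous_intros) auto
  have int: "integrable ?M (\<lambda>x. (x \<bullet> b) * (gradient \<phi> x \<bullet> b))" for b
    using sq_integrable_inner[OF L2 sq_integrable_component[OF sq_integrable_test_function(2)[OF \<phi>]]] by simp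
  have "(LINT x|?M. gradient \<phi> x \<bullet> ball_torsion_gradient x)
      = (LINT x|?M. (- 1 / DIM('a)) * (\<Sum>b\<in>Basis. (x \<bullet> b) * (gradient \<phi> x \<bullet> b)))"
  proof (intro Bochner_Integration.integral_cong refl)
    fix x :: 'a
    have "gradient \<phi> x \<bullet> ball_torsion_gradient x = (- 1 / DIM('a)) * (x \<bullet> gradient \<phi> x)"
      by (simp add: ball_torsion_gradient_def inner_commute)
    also have "x \<bullet> gradient \<phi> x = (\<Sum>b\<in>Basis. (x \<bullet> b) * (gradient \<phi> x \<bullet> b))"
      by (rule euclidean_inner)
    finally show "gradient \<phi> x \<bullet> ball_torsion_gradient x
        = (- 1 / DIM('a)) * (\<Sum>b\<in>Basis. (x \<bullet> b) * (gradient \<phi> x \<bullet> b))" .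
  qed
  also have "\<dots> = (- 1 / DIM('a)) * (\<Sum>b\<in>Basis. LINT x|?M. (x \<bullet> b) * (gradient \<phi> x \<bullet> b))"
    using int by (simp add: Bochner_Integration.integral_sum)
  also have "\<dots> = (LINT x|?M. \<phi> x)" by (simp add: part)
  finally show ?thesis .
qed

text \<open>
  The symmetry of the Dirichlet form, \<open>\<integral> u = \<integral> \<nabla>u \<bullet> \<nabla>w = \<integral> f * w\<close>.  For the first equation \<open>u\<close> is
  approximated by test functions, for the second \<open>w\<close> is.

  Membership in \<open>H10\<close> and the weak equation each come with a weak gradient of \<open>u\<close>, say \<open>g1\<close> and
  \<open>g2\<close>.  They need only be compared by pairing with \<open>\<nabla>(approx_torsion k)\<close>.  The
  components of this field are test functions, so the definition of a weak gradient expresses both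
  pairings through \<open>u\<close> alone.
\<close>

theorem integral_weak_solution:
  fixes f u :: "'a::euclidean_space \<Rightarrow> real"
  assumes u: "weak_solution (ball 0 1) f u" and f: "integrable unit_ball_measure f"
  shows "(LINT x:ball 0 1|lebesgue. u x) = (LINT x|unit_ball_measure. f x * ball_torsion x)"
proof -
  let ?B = "ball 0 1 :: 'a set"
  let ?M = "unit_ball_measure :: 'a measure"
  let ?W = "ball_torsion_gradient :: 'a \<Rightarrow> 'a"
  let ?w = "approx_torsion :: nat \<Rightarrow> 'a \<Rightarrow> real"
  have B: "?B \<in> sets lebesgue" by simp
  interpret finite_measure ?M by (rule finite_unit_ball_measure)
  note unfolds = set_lebesgue_integral_lebesgue_on[OF B] square_integrable_on_iff[OF B]
  obtain g1 v where g1: "has_weak_gradient ?B u g1" and v: "\<And>k::nat. v k \<in> test_functions ?B"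
    and lim: "(\<lambda>k. (LINT x|?M. (v k x - u x)\<^sup>2) + (LINT x|?M. (norm (gradient (v k) x - g1 x))\<^sup>2)) \<longlonglongrightarrow> 0"
    using u unfolding weak_solution_def H10_def unfolds by blast
  obtain g2 where g2: "has_weak_gradient ?B u g2"
    and eq: "\<And>\<phi>. \<phi> \<in> test_functions ?B \<Longrightarrow> (LINT x|?M. g2 x \<bullet> gradient \<phi> x) = (LINT x|?M. f x * \<phi> x)"
    using u unfolding weak_solution_def unfolds by blast
  have L2: "sq_integrable ?M u" "sq_integrable ?M g1" "sq_integrable ?M g2"
    using g1 g2 unfolding has_weak_gradient_def unfolds by auto
  have "(\<lambda>k. l2_dist_sq ?M (v k) u) \<longlonglongrightarrow> 0" 
    by (rule tendsto_sandwich[OF always_eventually always_eventually tendsto_const lim])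
      (auto simp: l2_dist_sq_def)
  moreover have "sq_integrable ?M (\<lambda>_. 1::real)" by (simp add: sq_integrable_def)
  ultimately have "(\<lambda>k. LINT x|?M. v k x) \<longlonglongrightarrow> (LINT x|?M. u x)"
    using l2_tendsto_inner[OF sq_integrable_test_function(1)[OF v] L2(1), of "\<lambda>_. 1"] by simp
  moreover have W: "sq_integrable ?M ?W"
    by (rule sq_integrable_continuous[OF continuous_ball_torsion_gradient]) auto
  have "(\<lambda>k. l2_dist_sq ?M (gradient (v k)) g1) \<longlonglongrightarrow> 0" 
    by (rule tendsto_sandwich[OF always_eventually always_eventually tendsto_const lim])
      (auto simp: l2_dist_sq_def)
  then have "(\<lambda>k. LINT x|?M. gradient (v k) x \<bullet> ?W x) \<longlonglongrightarrow> (LINT x|?M. g1 x \<bullet> ?W x)"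
    by (rule l2_tendsto_inner[OF sq_integrable_test_function(2)[OF v] L2(2) W])
  ultimately have u_eq: "(LINT x|?M. u x) = (LINT x|?M. g1 x \<bullet> ?W x)"
    unfolding integral_test_function_eq[OF v] by (rule LIMSEQ_unique)
  have g12: "(LINT x|?M. g1 x \<bullet> gradient (?w k) x) = (LINT x|?M. g2 x \<bullet> gradient (?w k) x)" for k
  proof -
    let ?p = "\<lambda>b x. gradient (?w k) x \<bullet> b"
    have expand: "(LINT x|?M. g x \<bullet> gradient (?w k) x) = (\<Sum>b\<in>Basis. - (LINT x|?M. u x * (gradient (?p b) x \<bullet> b)))"
      if g: "has_weak_gradient ?B u g" for g
    proof -
      have L2g: "sq_integrable ?M g" using g unfolding has_weak_gradient_def unfolds by auto
      have "(LINT x|?M. g x \<bullet> gradient (?w k) x) = (LINT x|?M. (\<Sum>b\<in>Basis. (g x \<bullet> b) * ?p b x))"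
        by (intro Bochner_Integration.integral_cong refl euclidean_inner)
      also have "\<dots> = (\<Sum>b\<in>Basis. LINT x|?M. (g x \<bullet> b) * ?p b x)"
        using sq_integrable_inner[OF sq_integrable_component[OF L2g]
            sq_integrable_component[OF sq_integrable_test_function(2)[OF approx_torsion_test_function]]]
        by (intro Bochner_Integration.integral_sum) auto
      also have "\<dots> = (\<Sum>b\<in>Basis. - (LINT x|?M. u x * (gradient (?p b) x \<bullet> b)))"
      proof (intro sum.cong refl)
        fix b :: 'a assume b: "b \<in> Basis"
        then have "?p b \<in> test_functions ?B" by (rule approx_torsion_partial_test_function)
        then have "(LINT x|?M. u x * (gradient (?p b) x \<bullet> b)) = - (LINT x|?M. (g x \<bullet> b) * ?p b x)"
          using g b unfolding has_weak_gradient_def unfolds by blast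
        then show "(LINT x|?M. (g x \<bullet> b) * ?p b x) = - (LINT x|?M. u x * (gradient (?p b) x \<bullet> b))"
          by simp
      qed
      finally show ?thesis .
    qed
    show ?thesis unfolding expand[OF g1] expand[OF g2] ..
  qed
  have "(\<lambda>k. LINT x|?M. gradient (?w k) x \<bullet> g1 x) \<longlonglongrightarrow> (LINT x|?M. ?W x \<bullet> g1 x)"
    by (rule l2_tendsto_inner[OF sq_integrable_test_function(2)[OF approx_torsion_test_function] W L2(2) approx_gradient_tendsto])
  then have "(\<lambda>k. LINT x|?M. f x * ?w k x) \<longlonglongrightarrow> (LINT x|?M. g1 x \<bullet> ?W x)"
    by (simp add: inner_commute g12 eq[OF approx_torsion_test_function, symmetric])
  then have "(LINT x|?M. g1 x \<bullet> ?W x) = (LINT x|?M. f x * ball_torsion x)"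
    using approx_torsion_integral_tendsto[OF f] by (rule LIMSEQ_unique)
  then show ?thesis using u_eq by (simp add: set_lebesgue_integral_lebesgue_on)
qed

theorem torsion_functional_eq:
  fixes E :: "'a::euclidean_space set"
  assumes E: "E \<in> sets lebesgue" "E \<subseteq> ball 0 1"
  shows "torsion_functional E = (LINT x:E|lebesgue. ball_torsion x)"
proof -
  let ?M = "unit_ball_measure :: 'a measure"
  interpret finite_measure ?M by (rule finite_unit_ball_measure)
  have EM: "E \<in> sets ?M" using E by (auto simp: sets_restrict_space)
  have int: "integrable ?M (indicat_real E)"
    using EM by (intro integrable_real_indicator) (auto simp: less_top[symmetric])
  have "sq_integrable ?M (indicat_real E)"
  proof -
    have "(norm (indicat_real E x))\<^sup>2 = indicat_real E x" for x by (simp add: indicator_def)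
    then show ?thesis using EM int by (simp add: sq_integrable_def)
  qed
  then have "weak_solution (ball 0 1) (indicat_real E) (torsion E)"
    unfolding torsion_def by (rule someI_ex[OF weak_solution_exists])
  from integral_weak_solution[OF this int]
  have "torsion_functional E = (LINT x|?M. indicat_real E x * ball_torsion x)"
    by (simp add: torsion_functional_def)
  also have "\<dots> = (LINT x|lebesgue. indicator (ball 0 1) x *\<^sub>R (indicat_real E x * ball_torsion x))"
    by (rule integral_restrict_space) simp
  also have "\<dots> = (LINT x:E|lebesgue. ball_torsion x)"
    unfolding set_lebesgue_integral_def using E(2)
    by (intro Bochner_Integration.integral_cong) (auto simp: indicator_def)
  finally show ?thesis .
qed

section \<open>The deficit as a transport cost\<close>

lemma set_integrable_continuous:
  fixes f :: "'a::euclidean_space \<Rightarrow> real"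
  assumes "continuous_on UNIV f" "D \<in> sets lebesgue" "bounded D"
  shows "set_integrable lebesgue D f"
proof -
  obtain a where a: "D \<subseteq> cbox (-a) a"
    using bounded_subset_cbox_symmetric[OF assms(3)] by blast
  have "set_integrable lebesgue (cbox (-a) a) f"
    by (intro absolutely_integrable_continuous continuous_on_subset[OF assms(1)]) auto
  then show ?thesis by (rule set_integrable_subset) (use assms a in auto)
qed

lemma set_integral_const_bounded:
  fixes D :: "'a::euclidean_space set" and c :: real
  assumes "D \<in> sets lebesgue" "bounded D"
  shows "(LINT x:D|lebesgue. c) = c * measure lebesgue D"
proof -
  have "emeasure lebesgue D \<noteq> \<infinity>"
    unfolding infinity_ennreal_def using assms by (intro fmeasurableD2 bounded_set_imp_lmeasurable)
  then show ?thesis using set_integral_const[OF assms(1), of c] by simp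
qed

lemma set_integral_bounds:
  fixes f :: "'a::euclidean_space \<Rightarrow> real"
  assumes "continuous_on UNIV f" "D \<in> sets lebesgue" "bounded D"
  shows "(\<And>x. x \<in> D \<Longrightarrow> c \<le> f x) \<Longrightarrow> c * measure lebesgue D \<le> (LINT x:D|lebesgue. f x)"
    and "(\<And>x. x \<in> D \<Longrightarrow> f x \<le> c) \<Longrightarrow> (LINT x:D|lebesgue. f x) \<le> c * measure lebesgue D"
proof -
  have c: "(LINT x:D|lebesgue. c) = c * measure lebesgue D"
    using assms by (intro set_integral_const_bounded)
  have i: "set_integrable lebesgue D (\<lambda>_. c)" "set_integrable lebesgue D f"
    using assms by (auto intro!: set_integrable_continuous)
  show "(\<And>x. x \<in> D \<Longrightarrow> c \<le> f x) \<Longrightarrow> c * measure lebesgue D \<le> (LINT x:D|lebesgue. f x)"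
    unfolding c[symmetric] by (rule set_integral_mono[OF i])
  show "(\<And>x. x \<in> D \<Longrightarrow> f x \<le> c) \<Longrightarrow> (LINT x:D|lebesgue. f x) \<le> c * measure lebesgue D"
    unfolding c[symmetric] by (rule set_integral_mono[OF i(2,1)])
qed

lemma measure_split:
  fixes A B :: "'a::euclidean_space set"
  assumes "A \<in> sets lebesgue" "B \<in> sets lebesgue" "bounded A"
  shows "measure lebesgue A = measure lebesgue (A \<inter> B) + measure lebesgue (A - B)"
proof -
  have A: "A \<inter> B \<in> lmeasurable" "A - B \<in> lmeasurable"
    using assms by (auto intro!: bounded_set_imp_lmeasurable intro: bounded_subset)
  have "A = (A \<inter> B) \<union> (A - B)" by blast
  then show ?thesis using measure_Un3[OF A] by (metis Diff_disjoint Int_Diff inf_commute measure_empty diff_zero)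
qed

lemma
  fixes A B :: "'a::euclidean_space set"
  assumes "A \<in> sets lebesgue" "B \<in> sets lebesgue" "bounded A" "bounded B"
    and eq: "measure lebesgue A = measure lebesgue B"
  shows measure_Diff_swap: "measure lebesgue (B - A) = measure lebesgue (A - B)"
    and measure_sym_diff: "measure lebesgue (sym_diff A B) = 2 * measure lebesgue (A - B)"
proof -
  show swap: "measure lebesgue (B - A) = measure lebesgue (A - B)"
    using measure_split[OF assms(1,2,3)] measure_split[OF assms(2,1,4)] eq by (simp add: Int_commute)
  have "measure lebesgue (sym_diff A B) = measure lebesgue (A - B) + measure lebesgue (B - A)"
  proof -
    have "sym_diff A B \<inter> A = A - B" "sym_diff A B - A = B - A" by blast+
    then show ?thesis using measure_split[of "sym_diff A B" A] assms
      by (auto intro: bounded_subset)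
  qed
  then show "measure lebesgue (sym_diff A B) = 2 * measure lebesgue (A - B)"
    using swap by simp
qed

text \<open>
  Subtracting the constant \<open>(1 - r\<^sup>2) / (2 * n)\<close> from the torsion of the ball does not change the
  difference of its integrals over two sets of the same volume, and makes it vanish on the sphere of
  radius \<open>r\<close>.  The integrals over the intersection cancel.
\<close>

lemma torsion_deficit:
  fixes E :: "'a::euclidean_space set" and r :: real
  assumes E: "E \<in> sets lebesgue" "E \<subseteq> ball 0 1" and r: "0 < r" "r \<le> 1"
    and vol: "measure lebesgue E = measure lebesgue (ball (0::'a) r)"
  shows "torsion_functional (ball (0::'a) r) - torsion_functional E =
      ((LINT x:ball 0 r - E|lebesgue. r\<^sup>2 - (norm x)\<^sup>2) + (LINT x:E - ball 0 r|lebesgue. (norm x)\<^sup>2 - r\<^sup>2)) / (2 * DIM('a))"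
proof -
  let ?B = "ball (0::'a) r"
  let ?h = "\<lambda>x::'a. r\<^sup>2 - (norm x)\<^sup>2"
  have bdd: "bounded E" using E(2) bounded_ball bounded_subset by blast
  have B: "?B \<in> sets lebesgue" "?B \<subseteq> ball 0 1" using r by auto
  have int: "set_integrable lebesgue D ?h" if "D \<in> sets lebesgue" "bounded D" for D
    using that by (intro set_integrable_continuous continuous_intros)
  have J: "2 * DIM('a) * torsion_functional D = (LINT x:D|lebesgue. ?h x) + (1 - r\<^sup>2) * measure lebesgue D"
    if D: "D \<in> sets lebesgue" "D \<subseteq> ball 0 1" for D
  proof -
    have bD: "bounded D" using D(2) bounded_ball bounded_subset by blast
    have "torsion_functional D = (LINT x:D|lebesgue. (?h x + (1 - r\<^sup>2)) / (2 * DIM('a)))"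
      unfolding torsion_functional_eq[OF D] by (simp add: ball_torsion_def[abs_def])
    also have "\<dots> = (LINT x:D|lebesgue. ?h x + (1 - r\<^sup>2)) / (2 * DIM('a))"
      by (simp add: set_integral_divide_zero)
    also have "(LINT x:D|lebesgue. ?h x + (1 - r\<^sup>2)) = (LINT x:D|lebesgue. ?h x) + (LINT x:D|lebesgue. 1 - r\<^sup>2)"
      by (rule set_integral_add(2)[OF int[OF D(1) bD]])
        (intro set_integrable_continuous continuous_intros D bD)
    also have "(LINT x:D|lebesgue. 1 - r\<^sup>2) = (1 - r\<^sup>2) * measure lebesgue D"
      by (rule set_integral_const_bounded[OF D(1) bD])
    finally show ?thesis by simp
  qed
  have split: "(LINT x:A|lebesgue. ?h x) = (LINT x:A \<inter> C|lebesgue. ?h x) + (LINT x:A - C|lebesgue. ?h x)"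
    if "A \<in> sets lebesgue" "C \<in> sets lebesgue" "bounded A" for A C
  proof -
    have "(A \<inter> C) \<union> (A - C) = A" by blast
    moreover have "(LINT x:(A \<inter> C) \<union> (A - C)|lebesgue. ?h x) = (LINT x:A \<inter> C|lebesgue. ?h x) + (LINT x:A - C|lebesgue. ?h x)"
      by (rule set_integral_Un) (use that in \<open>auto intro!: int intro: bounded_subset\<close>)
    ultimately show ?thesis by simp
  qed
  have neg: "(LINT x:E - ?B|lebesgue. (norm x)\<^sup>2 - r\<^sup>2) = - (LINT x:E - ?B|lebesgue. ?h x)"
    by (simp add: set_lebesgue_integral_def flip: integral_minus) (simp add: algebra_simps)
  have "2 * DIM('a) * (torsion_functional ?B - torsion_functional E) = (LINT x:?B|lebesgue. ?h x) - (LINT x:E|lebesgue. ?h x)"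
    using J[OF B] J[OF E] vol by (simp add: right_diff_distrib)
  also have "\<dots> = (LINT x:?B - E|lebesgue. ?h x) + (LINT x:E - ?B|lebesgue. (norm x)\<^sup>2 - r\<^sup>2)"
    using split[OF B(1) E(1) bounded_ball] split[OF E(1) B(1) bdd] neg by (simp add: Int_commute)
  finally show ?thesis by (simp add: field_simps)
qed

lemma measure_ball_0:
  "r \<ge> 0 \<Longrightarrow> measure lebesgue (ball (0::'a::euclidean_space) r) = unit_ball_vol DIM('a) * r ^ DIM('a)"
  using content_ball[of r "0::'a"] by simp

lemma measure_shell:
  assumes "0 \<le> s" "s \<le> r"
  shows "measure lebesgue (ball (0::'a::euclidean_space) r - ball 0 s) = unit_ball_vol DIM('a) * (r ^ DIM('a) - s ^ DIM('a))"
proof -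
  have "ball (0::'a) r \<inter> ball 0 s = ball 0 s" using assms by auto
  then show ?thesis
    using measure_split[of "ball (0::'a) r" "ball 0 s"] 
      measure_ball_0[of r, where 'a = 'a] measure_ball_0[of s, where 'a = 'a] assms
    by (simp add: right_diff_distrib)
qed

text \<open>
  Bernoulli's inequality bounds the volume of the layer of thickness \<open>\<eta>\<close> inside the sphere by
  \<open>n * V * r ^ (n - 1) * \<eta>\<close>, where \<open>V\<close> is the volume of the unit ball.  If \<open>\<eta>\<close> makes this bound half
  the volume of \<open>D\<close>, then the other half of \<open>D\<close> lies deeper, where the integrand is at least
  \<open>r * \<eta>\<close>.
\<close>

lemma inner_transport_lower_bound:
  fixes D :: "'a::euclidean_space set" and r :: real
  assumes r: "r > 0" and D: "D \<in> sets lebesgue" "D \<subseteq> ball 0 r"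
  shows "(measure lebesgue D)\<^sup>2 * r / (4 * unit_ball_vol DIM('a) * DIM('a) * r ^ (DIM('a) - 1))
      \<le> (LINT x:D|lebesgue. r\<^sup>2 - (norm x)\<^sup>2)"
proof -
  let ?n = "DIM('a)"
  let ?V = "unit_ball_vol (real ?n)"
  let ?P = "?V * real ?n * r ^ (?n - 1)"
  define d where "d = measure lebesgue D"
  have n: "1 \<le> real ?n" using DIM_ge_Suc0[where 'a='a] by linarith
  have rn: "r ^ ?n = r * r ^ (?n - 1)" by (metis DIM_positive power_eq_if neq0_conv)
  have V: "?V > 0" by simp
  have P: "?P > 0" using V n r by simp
  have bD: "bounded D" using D(2) bounded_ball bounded_subset by blast
  have "d \<ge> 0" by (simp add: d_def)
  have "d \<le> measure lebesgue (ball (0::'a) r)"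
    unfolding d_def using D by (intro measure_mono_fmeasurable) auto
  also have "\<dots> = ?V * (r * r ^ (?n - 1))" using r by (simp only: measure_ball_0 rn less_imp_le)
  also have "\<dots> \<le> r * ?P" using n r V by (simp add: mult_le_cancel_left2)
  finally have dP: "d \<le> r * ?P" .
  define \<eta> where "\<eta> = d / (2 * ?P)"
  have eta: "0 \<le> \<eta>" "\<eta> \<le> r" 
    using dP P \<open>d \<ge> 0\<close> r by (auto simp: \<eta>_def divide_le_eq)
  define s where "s = r - \<eta>"
  have s: "0 \<le> s" "s \<le> r" using eta by (auto simp: s_def)
  have shell: "measure lebesgue (ball (0::'a) r - ball 0 s) \<le> d / 2"
  proof -
    have "1 + real ?n * (- \<eta> / r) \<le> (1 + (- \<eta> / r)) ^ ?n"
      using eta r by (intro Bernoulli_inequality) (simp add: field_simps)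
    also have "1 + (- \<eta> / r) = s / r" using r by (simp add: s_def field_simps)
    finally have "r ^ ?n * (1 + real ?n * (- \<eta> / r)) \<le> r ^ ?n * (s / r) ^ ?n"
      using r by (intro mult_left_mono) auto
    also have "r ^ ?n * (s / r) ^ ?n = s ^ ?n" using r by (simp add: power_divide)
    also have "r ^ ?n * (1 + real ?n * (- \<eta> / r)) = r ^ ?n - real ?n * \<eta> * r ^ (?n - 1)"
      using r by (simp add: rn field_simps)
    finally have "r ^ ?n - s ^ ?n \<le> real ?n * \<eta> * r ^ (?n - 1)" by simp
    then have "?V * (r ^ ?n - s ^ ?n) \<le> ?V * (real ?n * \<eta> * r ^ (?n - 1))"
      using V by (intro mult_left_mono) auto
    also have "\<dots> = ?P * \<eta>" by simp
    also have "\<dots> = d / 2"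
    proof -
      have "p * (d / (2 * p)) = d / 2" if "p > 0" for p :: real using that by simp
      from this[OF P] show ?thesis by (simp only: \<eta>_def)
    qed
    finally show ?thesis using measure_shell[OF s, where 'a = 'a] by simp
  qed
  have "measure lebesgue (D - ball 0 s) \<le> measure lebesgue (ball (0::'a) r - ball 0 s)"
    using D by (intro measure_mono_fmeasurable)
      (auto intro!: bounded_set_imp_lmeasurable intro: bounded_subset[OF bounded_ball])
  then have half: "d / 2 \<le> measure lebesgue (D \<inter> ball 0 s)"
    using shell measure_split[OF D(1) _ bD, of "ball 0 s"] by (simp add: d_def)
  have c: "continuous_on UNIV (\<lambda>x::'a. r\<^sup>2 - (norm x)\<^sup>2)" by (intro continuous_intros)
  have nonneg: "0 \<le> r\<^sup>2 - (norm x)\<^sup>2" if "x \<in> D" for x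
  proof -
    have "norm x < r" using that D(2) by auto
    then show ?thesis by (simp add: power_mono)
  qed
  have "r * \<eta> * (d / 2) \<le> r * \<eta> * measure lebesgue (D \<inter> ball 0 s)"
    using half r eta by (intro mult_left_mono) auto
  also have "\<dots> \<le> (LINT x:D \<inter> ball 0 s|lebesgue. r\<^sup>2 - (norm x)\<^sup>2)"
  proof (rule set_integral_bounds(1)[OF c])
    fix x assume "x \<in> D \<inter> ball 0 s"
    then have "(norm x)\<^sup>2 \<le> s\<^sup>2" by (intro power_mono) auto
    moreover have "r\<^sup>2 - s\<^sup>2 = r * \<eta> + s * \<eta>"
      by (simp add: s_def power2_eq_square algebra_simps)
    moreover have "0 \<le> s * \<eta>" using s eta by simp
    ultimately show "r * \<eta> \<le> r\<^sup>2 - (norm x)\<^sup>2" by linarith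
  qed (use D bD in \<open>auto intro: bounded_subset\<close>)
  also have "\<dots> \<le> (LINT x:D|lebesgue. r\<^sup>2 - (norm x)\<^sup>2)"
  proof -
    have "set_integrable lebesgue (D \<inter> ball 0 s) (\<lambda>x. r\<^sup>2 - (norm x)\<^sup>2)"
      "set_integrable lebesgue D (\<lambda>x. r\<^sup>2 - (norm x)\<^sup>2)"
      using D(1) bD by (auto intro!: set_integrable_continuous[OF c] intro: bounded_subset)
    then show ?thesis
      unfolding set_integrable_def set_lebesgue_integral_def
      by (rule integral_mono) (use nonneg in \<open>auto simp: indicator_def\<close>)
  qed
  also have "r * \<eta> * (d / 2) = d\<^sup>2 * r / (4 * ?P)"
    by (simp add: \<eta>_def power2_eq_square mult_ac)
  finally show ?thesis by (simp add: d_def mult.assoc)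
qed

theorem torsion_quantitative:
  fixes E :: "'a::euclidean_space set" and r :: real
  assumes E: "E \<in> sets lebesgue" "E \<subseteq> ball 0 1" and r: "0 < r" "r \<le> 1"
    and vol: "measure lebesgue E = measure lebesgue (ball (0::'a) r)"
  shows "r / (32 * unit_ball_vol DIM('a) * (real DIM('a))\<^sup>2 * r ^ (DIM('a) - 1))
      * (measure lebesgue (sym_diff E (ball 0 r)))\<^sup>2
    \<le> torsion_functional (ball (0::'a) r) - torsion_functional E"
proof -
  let ?B = "ball (0::'a) r"
  let ?n = "DIM('a)"
  let ?d = "measure lebesgue (?B - E)"
  have bE: "bounded E" using E(2) bounded_ball bounded_subset by blast
  have sd: "measure lebesgue (sym_diff E ?B) = 2 * ?d"
    using measure_sym_diff[OF E(1) _ bE bounded_ball vol] measure_Diff_swap[OF E(1) _ bE bounded_ball vol] by simp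
  have "0 * measure lebesgue (E - ?B) \<le> (LINT x:E - ?B|lebesgue. (norm x)\<^sup>2 - r\<^sup>2)"
  proof (rule set_integral_bounds(1))
    show "continuous_on UNIV (\<lambda>x::'a. (norm x)\<^sup>2 - r\<^sup>2)" by (intro continuous_intros)
    show "0 \<le> (norm x)\<^sup>2 - r\<^sup>2" if "x \<in> E - ?B" for x
      using that r by (simp add: power_mono)
  qed (use E bE in \<open>auto intro: bounded_subset\<close>)
  moreover have "?d\<^sup>2 * r / (4 * unit_ball_vol ?n * ?n * r ^ (?n - 1)) \<le> (LINT x:?B - E|lebesgue. r\<^sup>2 - (norm x)\<^sup>2)"
    by (rule inner_transport_lower_bound[OF r(1)]) (use E in auto)
  ultimately have "?d\<^sup>2 * r / (4 * unit_ball_vol ?n * ?n * r ^ (?n - 1)) / (2 * ?n) \<le> torsion_functional ?B - torsion_functional E"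
    unfolding torsion_deficit[OF E r vol] by (intro divide_right_mono) auto
  then show ?thesis unfolding sd by (simp add: power_mult_distrib power2_eq_square field_simps)
qed

section \<open>Optimality of the exponent\<close>

text \<open>
  The mass of the shell between radii \<open>s\<close> and \<open>r\<close> moves to the shell between \<open>r\<close> and \<open>R\<close>, where
  \<open>s ^ n = r ^ n - \<delta>\<close> and \<open>R ^ n = r ^ n + \<delta>\<close>.  Volume \<open>V * \<delta>\<close> is moved, at a unit cost of
  \<open>R\<^sup>2 - s\<^sup>2\<close> at most, and \<open>R - s\<close> is of order \<open>\<delta>\<close>.
\<close>

lemma shell_competitor:
  fixes r \<delta> :: real
  assumes r: "0 < r" "r < 1" and \<delta>: "0 < \<delta>" "\<delta> \<le> r ^ DIM('a)" "\<delta> \<le> 1 - r ^ DIM('a)"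
  obtains E :: "'a::euclidean_space set"
  where "E \<in> sets lebesgue" "E \<subseteq> ball 0 1" "measure lebesgue E = measure lebesgue (ball (0::'a) r)"
    "measure lebesgue (sym_diff E (ball 0 r)) = 2 * unit_ball_vol DIM('a) * \<delta>"
    "torsion_functional (ball (0::'a) r) - torsion_functional E
       \<le> 2 * unit_ball_vol DIM('a) / (DIM('a) * r ^ (DIM('a) - 1)) * \<delta>\<^sup>2"
proof -
  let ?n = "DIM('a)"
  let ?V = "unit_ball_vol (real ?n)"
  define R where "R = root ?n (r ^ ?n + \<delta>)"
  define s where "s = root ?n (r ^ ?n - \<delta>)"
  have rr: "root ?n (r ^ ?n) = r" using r by (simp add: real_root_power_cancel)
  have Rn: "R ^ ?n = r ^ ?n + \<delta>" and sn: "s ^ ?n = r ^ ?n - \<delta>"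
    using r \<delta> by (simp_all add: R_def s_def real_root_pow_pos2)
  have s0: "0 \<le> s" using \<delta> by (simp add: s_def)
  have "root ?n (r ^ ?n - \<delta>) < root ?n (r ^ ?n)" using \<delta> by (intro real_root_less_mono) auto
  then have sr: "s < r" by (simp add: rr s_def)
  have "root ?n (r ^ ?n) < root ?n (r ^ ?n + \<delta>)" using \<delta> by (intro real_root_less_mono) auto
  then have rR: "r < R" by (simp add: rr R_def)
  have "root ?n (r ^ ?n + \<delta>) \<le> root ?n 1" using \<delta> by (intro real_root_le_mono) auto
  then have R1: "R \<le> 1" by (simp add: R_def)
  define E where "E = ball 0 s \<union> (ball (0::'a) R - ball 0 r)"
  let ?B = "ball (0::'a) r"
  have E: "E \<in> sets lebesgue" "E \<subseteq> ball 0 1"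
    using sr rR R1 r by (auto simp: E_def)
  have bE: "bounded E" using E(2) bounded_ball bounded_subset by blast
  have EB: "E - ?B = ball 0 R - ?B" and BE: "?B - E = ?B - ball 0 s" and EiB: "E \<inter> ?B = ball 0 s"
    using sr rR by (auto simp: E_def)
  have mEB: "measure lebesgue (E - ?B) = ?V * \<delta>" and mBE: "measure lebesgue (?B - E) = ?V * \<delta>"
    unfolding EB BE using r rR s0 sr
      measure_shell[of r R, where 'a = 'a] measure_shell[of s r, where 'a = 'a] by (simp_all add: Rn sn)
  have vol: "measure lebesgue E = measure lebesgue ?B"
    using measure_split[OF E(1) _ bE, of ?B] mEB s0 r
      measure_ball_0[of s, where 'a = 'a] measure_ball_0[of r, where 'a = 'a]
    by (simp add: EiB sn algebra_simps)
  have sd: "measure lebesgue (sym_diff E ?B) = 2 * ?V * \<delta>"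
    using measure_sym_diff[OF E(1) _ bE bounded_ball vol] mEB by simp
  have "(LINT x:?B - E|lebesgue. r\<^sup>2 - (norm x)\<^sup>2) \<le> (r\<^sup>2 - s\<^sup>2) * measure lebesgue (?B - E)"
  proof (rule set_integral_bounds(2))
    show "continuous_on UNIV (\<lambda>x::'a. r\<^sup>2 - (norm x)\<^sup>2)" by (intro continuous_intros)
    show "r\<^sup>2 - (norm x)\<^sup>2 \<le> r\<^sup>2 - s\<^sup>2" if "x \<in> ?B - E" for x
      using that s0 unfolding BE by (simp add: power_mono)
  qed (use E in \<open>auto intro: bounded_subset[OF bounded_ball]\<close>)
  moreover have "(LINT x:E - ?B|lebesgue. (norm x)\<^sup>2 - r\<^sup>2) \<le> (R\<^sup>2 - r\<^sup>2) * measure lebesgue (E - ?B)"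
  proof (rule set_integral_bounds(2))
    show "continuous_on UNIV (\<lambda>x::'a. (norm x)\<^sup>2 - r\<^sup>2)" by (intro continuous_intros)
    show "(norm x)\<^sup>2 - r\<^sup>2 \<le> R\<^sup>2 - r\<^sup>2" if "x \<in> E - ?B" for x
      using that unfolding EB by (simp add: power_mono)
  qed (use E bE in \<open>auto intro: bounded_subset\<close>)
  ultimately have "(LINT x:?B - E|lebesgue. r\<^sup>2 - (norm x)\<^sup>2) + (LINT x:E - ?B|lebesgue. (norm x)\<^sup>2 - r\<^sup>2)
      \<le> (R\<^sup>2 - s\<^sup>2) * (?V * \<delta>)"
    unfolding mEB mBE by (simp add: algebra_simps)
  also have "\<dots> \<le> (4 * \<delta> / r ^ (?n - 1)) * (?V * \<delta>)"
  proof (rule mult_right_mono)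
    have pow: "x ^ ?n = x * x ^ (?n - 1)" for x :: real by (metis DIM_positive power_eq_if neq0_conv)
    \<comment> \<open>\<open>2 * \<delta> = R ^ n - s ^ n \<ge> (R - s) * R ^ (n - 1)\<close>, since \<open>s ^ (n - 1) \<le> R ^ (n - 1)\<close>.\<close>
    have "(R - s) * r ^ (?n - 1) \<le> (R - s) * R ^ (?n - 1)"
      using r rR sr by (intro mult_left_mono power_mono) auto
    also have "\<dots> = R ^ ?n - s * R ^ (?n - 1)" by (simp add: pow left_diff_distrib)
    also have "\<dots> \<le> R ^ ?n - s * s ^ (?n - 1)"
      using s0 sr rR by (intro diff_left_mono mult_left_mono power_mono) auto
    also have "\<dots> = 2 * \<delta>" using pow[of s] Rn sn by simp
    finally have "R - s \<le> 2 * \<delta> / r ^ (?n - 1)" using r by (simp add: field_simps)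
    moreover have "R\<^sup>2 - s\<^sup>2 = (R - s) * (R + s)" by (simp add: power2_eq_square algebra_simps)
    moreover have "(R - s) * (R + s) \<le> (R - s) * 2"
      using R1 sr rR r by (intro mult_left_mono) auto
    ultimately show "R\<^sup>2 - s\<^sup>2 \<le> 4 * \<delta> / r ^ (?n - 1)" by simp
  qed (use \<delta> in simp)
  finally have "torsion_functional ?B - torsion_functional E \<le> (4 * \<delta> / r ^ (?n - 1)) * (?V * \<delta>) / (2 * ?n)"
    unfolding torsion_deficit[OF E r(1) less_imp_le[OF r(2)] vol] by (intro divide_right_mono) auto
  also have "\<dots> = 2 * ?V / (?n * r ^ (?n - 1)) * \<delta>\<^sup>2"
    by (simp add: power2_eq_square field_simps)
  finally show thesis using that E vol sd by blast
qed

lemma no_smaller_power: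
  fixes a c :: real
  assumes "\<alpha> < 2" "c > 0" "a > 0"
    and "\<And>y. 0 < y \<Longrightarrow> y < a \<Longrightarrow> c * y powr \<alpha> \<le> C * y\<^sup>2"
  shows False
proof -
  have "((\<lambda>y. C * y powr (2 - \<alpha>)) \<longlongrightarrow> C * 0 powr (2 - \<alpha>)) (at_right 0)"
    using assms(1) by (intro tendsto_mult tendsto_const tendsto_powr2 tendsto_ident_at) (auto simp: eventually_at_right_field intro: exI[of _ 1])
  moreover have "eventually (\<lambda>y. c \<le> C * y powr (2 - \<alpha>)) (at_right 0)"
  proof (rule eventually_at_rightI[of 0 a])
    fix y assume y: "y \<in> {0<..<a}"
    have "y\<^sup>2 = y powr \<alpha> * y powr (2 - \<alpha>)"
      using y by (simp add: powr_add[symmetric] powr_numeral)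
    then have "c * y powr \<alpha> \<le> (C * y powr (2 - \<alpha>)) * y powr \<alpha>"
      using assms(4)[of y] y by (simp add: mult.commute mult.left_commute)
    then show "c \<le> C * y powr (2 - \<alpha>)" using y by simp
  qed (rule assms)
  ultimately have "c \<le> C * 0 powr (2 - \<alpha>)"
    by (rule tendsto_lowerbound) simp
  then show False using assms by simp
qed

theorem proposition2p8:
  fixes m :: real
  assumes "0 < m" and "m < measure lebesgue (ball (0 :: real ^ 'n) 1)"
  shows "(\<exists>c>0. \<forall>E :: (real ^ 'n) set.
            E \<in> sets lebesgue \<and> E \<subseteq> ball 0 1 \<and> measure lebesgue E = m \<longrightarrow>
            torsion_functional (centered_ball m :: (real ^ 'n) set) - torsion_functional E
              \<ge> c * (measure lebesgue (sym_diff E (centered_ball m)))\<^sup>2) \<and>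
         (\<forall>\<alpha><2. \<not> (\<exists>c>0. \<forall>E :: (real ^ 'n) set.
            E \<in> sets lebesgue \<and> E \<subseteq> ball 0 1 \<and> measure lebesgue E = m \<and>
            measure lebesgue (sym_diff E (centered_ball m)) > 0 \<longrightarrow>
            torsion_functional (centered_ball m :: (real ^ 'n) set) - torsion_functional E
              \<ge> c * measure lebesgue (sym_diff E (centered_ball m)) powr \<alpha>))"
proof -
  let ?n = "DIM(real ^ 'n)"
  let ?V = "unit_ball_vol (real ?n)"
  have V: "?V > 0" by simp
  have n: "real ?n > 0" using DIM_positive[where 'a = "real ^ 'n"] by (simp only: of_nat_0_less_iff)
  obtain r where r: "r > 0" and B: "(centered_ball m :: (real ^ 'n) set) = ball 0 r"
    and m: "measure lebesgue (ball (0 :: real ^ 'n) r) = m"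
    using centered_ball[OF assms(1), where 'a = "real ^ 'n"] by metis
  have "?V * r ^ ?n < ?V * 1 ^ ?n"
    using assms(2) m measure_ball_0[of r, where 'a = "real ^ 'n"] measure_ball_0[of 1, where 'a = "real ^ 'n"] r by simp
  then have rn1: "r ^ ?n < 1" using V by simp
  then have r1: "r < 1" using r by (meson not_le_imp_less one_le_power not_less)
  show ?thesis
  proof (intro conjI allI impI notI)
    let ?c = "r / (32 * ?V * (real ?n)\<^sup>2 * r ^ (?n - 1))"
    have "?c > 0" using r V n by (intro divide_pos_pos mult_pos_pos zero_less_power) auto
    moreover have "?c * (measure lebesgue (sym_diff E (ball 0 r)))\<^sup>2 \<le> torsion_functional (ball (0 :: real ^ 'n) r) - torsion_functional E"
      if "E \<in> sets lebesgue" "E \<subseteq> ball 0 1" "measure lebesgue E = m" for E :: "(real ^ 'n) set"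
      by (rule torsion_quantitative) (use that r r1 m in auto)
    ultimately show "\<exists>c>0. \<forall>E :: (real ^ 'n) set.
            E \<in> sets lebesgue \<and> E \<subseteq> ball 0 1 \<and> measure lebesgue E = m \<longrightarrow>
            torsion_functional (centered_ball m :: (real ^ 'n) set) - torsion_functional E
              \<ge> c * (measure lebesgue (sym_diff E (centered_ball m)))\<^sup>2"
      unfolding B by blast
  next
    fix \<alpha> :: real assume \<alpha>: "\<alpha> < 2"
    assume "\<exists>c>0. \<forall>E :: (real ^ 'n) set.
            E \<in> sets lebesgue \<and> E \<subseteq> ball 0 1 \<and> measure lebesgue E = m \<and>
            measure lebesgue (sym_diff E (centered_ball m)) > 0 \<longrightarrow>
            torsion_functional (centered_ball m :: (real ^ 'n) set) - torsion_functional E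
              \<ge> c * measure lebesgue (sym_diff E (centered_ball m)) powr \<alpha>"
    then obtain c where c: "c > 0" and bound: "\<And>E :: (real ^ 'n) set. E \<in> sets lebesgue \<Longrightarrow> E \<subseteq> ball 0 1 \<Longrightarrow>
        measure lebesgue E = m \<Longrightarrow> measure lebesgue (sym_diff E (ball 0 r)) > 0 \<Longrightarrow>
        c * measure lebesgue (sym_diff E (ball 0 r)) powr \<alpha> \<le> torsion_functional (ball (0 :: real ^ 'n) r) - torsion_functional E"
      unfolding B by blast
    let ?\<delta>\<^sub>0 = "min (r ^ ?n) (1 - r ^ ?n)"
    let ?C = "2 * ?V / (?n * r ^ (?n - 1)) / (2 * ?V)\<^sup>2"
    show False
    proof (rule no_smaller_power[OF \<alpha> c])
      show "0 < 2 * ?V * ?\<delta>\<^sub>0" using r rn1 V by simp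
      fix y assume y: "0 < y" "y < 2 * ?V * ?\<delta>\<^sub>0"
      define \<delta> where "\<delta> = y / (2 * ?V)"
      have "\<delta> < ?\<delta>\<^sub>0" unfolding \<delta>_def using y V by (subst pos_divide_less_eq) (auto simp: mult.commute)
      then have \<delta>: "0 < \<delta>" "\<delta> \<le> r ^ ?n" "\<delta> \<le> 1 - r ^ ?n" using y V by (auto simp: \<delta>_def)
      have cancel: "p * (y / p) = y" if "p > 0" for p :: real using that by simp
      have y\<delta>: "2 * ?V * \<delta> = y"
        unfolding \<delta>_def by (rule cancel[OF mult_pos_pos[OF zero_less_numeral V]])
      obtain E :: "(real ^ 'n) set" where E: "E \<in> sets lebesgue" "E \<subseteq> ball 0 1"
        "measure lebesgue E = measure lebesgue (ball (0::real ^ 'n) r)"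
        "measure lebesgue (sym_diff E (ball 0 r)) = 2 * ?V * \<delta>"
        "torsion_functional (ball (0::real ^ 'n) r) - torsion_functional E \<le> 2 * ?V / (?n * r ^ (?n - 1)) * \<delta>\<^sup>2"
        by (rule shell_competitor[OF r r1 \<delta>])
      have sd: "measure lebesgue (sym_diff E (ball 0 r)) = y" using E(4) y\<delta> by simp
      have "c * y powr \<alpha> \<le> torsion_functional (ball (0::real ^ 'n) r) - torsion_functional E"
        using bound[OF E(1,2)] E(3) m y(1) unfolding sd by simp
      also have "\<dots> \<le> 2 * ?V / (?n * r ^ (?n - 1)) * \<delta>\<^sup>2" by (rule E(5))
      also have "\<dots> = ?C * y\<^sup>2" by (simp add: \<delta>_def power_divide)
      finally show "c * y powr \<alpha> \<le> ?C * y\<^sup>2" .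
    qed
  qed
qed

end
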